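(* Let $\varphi$ be a Jacob's ladder associated with $\mu(y)=7y\ln y$. Then, as $T\to\infty$, uniformly for $U\in\left(0,\frac{T}{\ln T}\right]$, $$\int_T^{T+U}Z^2(t)\,{\rm d}t=U\ln T\,\tan[\alpha(T,U)]\left\{1+\mathcal{O}\left(\frac{\ln\ln T}{\ln T}\right)\right\}.$$
   Context: Let $Z(t)=e^{i\vartheta(t)}\zeta(\tfrac12+it)$ be Hardy's function, where $\vartheta$ is the Riemann–Siegel theta function; $Z$ is real-valued and $Z^2(t)=|\zeta(\tfrac12+it)|^2$. Let $\mu(y)=7y\ln y$. A Jacob's ladder is a continuous, increasing, differentiable function $\varphi(T)$, defined for all sufficiently large $T$ with $\varphi(T)\to\infty$, which solves the nonlinear integral equation $$\int_0^{\mu[\varphi(T)]}Z^2(t)e^{-\frac{2}{\varphi(T)}t}\,{\rm d}t=\int_0^T Z^2(t)\,{\rm d}t.$$ For $T,U>0$ put $\tan[\alpha(T,U)]=\frac{\varphi(T+U)-\varphi(T)}{2U}$, the slope of the chord of the curve $y=\frac12\varphi(T)$ joining the points with abscissae $T$ and $T+U$. *)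

theory Defs
  imports "HOL-Analysis.Analysis"
begin

text \<open>Riemann zeta on the critical line, via the Dirichlet eta function:
  for Re s > 0, s not a zero of 1 - 2^(1-s),
  zeta(s) = eta(s) / (1 - 2^(1-s)),  eta(s) = sum_{n>=1} (-1)^(n-1) n^(-s)
  (conditionally convergent series, summed as the limit of partial sums).\<close>

definition zeta_crit :: "real \<Rightarrow> complex" where
  "zeta_crit t =
     (let s = Complex (1/2) t in
      (\<Sum>n. (-1) ^ n / (of_nat (Suc n)) powr s) / (1 - 2 powr (1 - s)))"

definition Z2 :: "real \<Rightarrow> real" where
  "Z2 t = (cmod (zeta_crit t))\<^sup>2"

definition mu :: "real \<Rightarrow> real" where
  "mu y = 7 * y * ln y"

definition jacobs_ladder :: "(real \<Rightarrow> real) \<Rightarrow> real \<Rightarrow> bool" where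
  "jacobs_ladder \<phi> T0 \<longleftrightarrow>
     continuous_on {T0..} \<phi> \<and>
     strict_mono_on {T0..} \<phi> \<and>
     (\<forall>T\<ge>T0. \<phi> differentiable (at T)) \<and>
     filterlim \<phi> at_top at_top \<and>
     (\<forall>T\<ge>T0. integral {0..mu (\<phi> T)} (\<lambda>t. Z2 t * exp (- (2 / \<phi> T) * t))
               = integral {0..T} Z2)"

text \<open>tan(alpha(T,U)): slope of the chord of y = phi(T)/2 over [T, T+U].\<close>
definition tan_alpha :: "(real \<Rightarrow> real) \<Rightarrow> real \<Rightarrow> real \<Rightarrow> real" where
  "tan_alpha \<phi> T U = (\<phi> (T + U) - \<phi> T) / (2 * U)"

end

theory Submission
  imports Defs "HOL-Probability.Characteristic_Functions" "HOL-Real_Asymp.Real_Asymp"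
begin

text \<open>
  Write \<open>F(y)\<close> for the left-hand side of the integral equation with \<open>\<phi>(T)\<close> replaced by \<open>y\<close>.
  The increments of \<open>F\<close> are governed by \<open>(2 / y\<^sup>2) L(2 / y)\<close>, where
  \<open>L(d) = \<integral>\<^sub>0\<^sup>\<infinity> t e\<^sup>-\<^sup>d\<^sup>t Z\<^sup>2(t) dt\<close>, and \<open>L(d) = (ln (1 / d) + O(1)) / d\<^sup>2\<close> as \<open>d \<rightarrow> 0\<close>; hence
  \<open>F\<close> has slope \<open>ln y / 2 + O(1)\<close>. Since \<open>\<integral>\<^sub>0\<^sup>T Z\<^sup>2 = F(\<phi>(T))\<close>, this forces
  \<open>T / (7 ln T) \<le> \<phi>(T) \<le> 40 T\<close>, so the slope of \<open>F\<close> between \<open>\<phi>(T)\<close> and \<open>\<phi>(T + U)\<close>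
  is \<open>ln T / 2 + O(ln ln T)\<close>.

  For \<open>L(d)\<close> take \<open>N = \<lceil>1 / d\<rceil>\<close> and, with \<open>s = 1/2 + it\<close>,
  \<open>\<zeta>(s) = \<Sum>\<^sub>n\<^sub>\<le>\<^sub>N n\<^sup>-\<^sup>s - N\<^sup>1\<^sup>-\<^sup>s / (1 - s) - s \<integral>\<^sub>N\<^sup>\<infinity> {x} x\<^sup>-\<^sup>s\<^sup>-\<^sup>1 dx\<close>.
  The diagonal of the Dirichlet polynomial gives the main term. Every other contribution is
  \<open>O(1 / d\<^sup>2)\<close>: integrating over \<open>t\<close> first replaces the products of oscillating factors by
  \<open>k! / (d + i x)\<^sup>k\<^sup>+\<^sup>1\<close>, which is dominated by the integrable kernel \<open>1 / (d\<^sup>2 + x\<^sup>2)\<close>.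
\<close>

section \<open>Exponential kernels\<close>

text \<open>Extended by zero to negative \<open>t\<close>, so that integrals over the half-line
  become Lebesgue integrals over the whole line, to which the Fourier identities below
  apply.\<close>

definition power_exp :: "nat \<Rightarrow> real \<Rightarrow> real \<Rightarrow> real" where
  "power_exp k d t = (if 0 \<le> t then t ^ k * exp (- (d * t)) else 0)"

lemma power_exp_nonneg: "0 \<le> power_exp k d t"
  by (simp add: power_exp_def)

lemma power_exp_measurable [measurable]: "power_exp k d \<in> borel_measurable borel"
  unfolding power_exp_def by measurable

text \<open>Induction on \<open>k\<close> through integration by parts. Allowing complex
  \<open>z\<close> serves two purposes: real \<open>z\<close> gives integrability of
  \<open>power_exp\<close>, and \<open>z = Complex d x\<close> gives its Fourier transform, as the
  value at 0 is explicit and the limit at infinity vanishes.\<close>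

lemma power_times_exp_antiderivative:
  fixes z :: complex
  assumes "0 < Re z"
  shows "\<exists>P. (\<forall>t. (P has_vector_derivative of_real t ^ k * exp (- (z * of_real t))) (at t)) \<and>
             (P \<longlongrightarrow> 0) at_top \<and> P 0 = - fact k / z ^ Suc k"
proof -
  have z: "z \<noteq> 0" using assms by auto
  have lim: "((\<lambda>t. of_real t ^ k * exp (- (z * of_real t))) \<longlongrightarrow> 0) at_top" for k
  proof (rule tendsto_norm_zero_cancel)
    have "((\<lambda>t. t ^ k * exp (- (Re z * t))) \<longlongrightarrow> 0) at_top"
    proof -
      have "((\<lambda>t. (t::real) ^ k / exp t) \<longlongrightarrow> 0) at_top"
        by (rule tendsto_power_div_exp_0)
      moreover have "filterlim (\<lambda>t. Re z * t) at_top at_top"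
        using assms by (intro filterlim_tendsto_pos_mult_at_top[OF tendsto_const _ filterlim_ident])
      ultimately have "((\<lambda>t. (Re z * t) ^ k / exp (Re z * t)) \<longlongrightarrow> 0) at_top"
        by (rule filterlim_compose)
      hence "((\<lambda>t. (1 / Re z ^ k) * ((Re z * t) ^ k / exp (Re z * t))) \<longlongrightarrow> (1 / Re z ^ k) * 0) at_top"
        by (intro tendsto_intros)
      thus ?thesis using assms
        by (simp add: power_mult_distrib exp_minus field_simps)
    qed
    thus "((\<lambda>t. norm (of_real t ^ k * exp (- (z * of_real t)) :: complex)) \<longlongrightarrow> 0) at_top"
    proof (rule Lim_transform_eventually)
      show "\<forall>\<^sub>F t in at_top. t ^ k * exp (- (Re z * t)) = norm (of_real t ^ k * exp (- (z * of_real t)) :: complex)"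
        using eventually_ge_at_top[of 0] by eventually_elim (simp add: norm_mult norm_power)
    qed
  qed
  show ?thesis
  proof (induction k)
    case 0
    have "((\<lambda>t. - (1 / z) * exp (- (z * of_real t))) has_vector_derivative exp (- (z * of_real t))) (at t)" for t
      using z by (auto intro!: derivative_eq_intros has_vector_derivative_real_field simp: field_simps)
    moreover have "((\<lambda>t. - (1 / z) * exp (- (z * of_real t))) \<longlongrightarrow> 0) at_top"
      using tendsto_mult_left[OF lim[of 0], of "- (1/z)"] by simp
    ultimately show ?case by (intro exI[of _ "\<lambda>t. - (1 / z) * exp (- (z * of_real t))"]) simp
  next
    case (Suc k)
    then obtain P where P: "\<And>t. (P has_vector_derivative of_real t ^ k * exp (- (z * of_real t))) (at t)"
       "(P \<longlongrightarrow> 0) at_top" "P 0 = - fact k / z ^ Suc k" by blast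
    define Q where "Q t = - (1 / z) * (of_real t ^ Suc k * exp (- (z * of_real t))) + of_nat (Suc k) / z * P t" for t
    have d: "((\<lambda>t. of_real t ^ Suc k * exp (- (z * of_real t))) has_vector_derivative
           (of_nat (Suc k) * of_real t ^ k * exp (- (z * of_real t)) - z * (of_real t ^ Suc k * exp (- (z * of_real t))))) (at t)" for t
      by (rule has_vector_derivative_real_field, (rule derivative_eq_intros refl)+) (simp add: algebra_simps)
    have "(Q has_vector_derivative - (1 / z) * (of_nat (Suc k) * of_real t ^ k * exp (- (z * of_real t)) - z * (of_real t ^ Suc k * exp (- (z * of_real t))))
         + of_nat (Suc k) / z * (of_real t ^ k * exp (- (z * of_real t)))) (at t)" for t
      unfolding Q_def by (intro has_vector_derivative_add has_vector_derivative_mult_right d P)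
    moreover have "- (1 / z) * (of_nat (Suc k) * of_real t ^ k * exp (- (z * of_real t)) - z * (of_real t ^ Suc k * exp (- (z * of_real t))))
         + of_nat (Suc k) / z * (of_real t ^ k * exp (- (z * of_real t))) = of_real t ^ Suc k * exp (- (z * of_real t))" for t
      using z by (simp add: field_simps)
    moreover have "(Q \<longlongrightarrow> - (1 / z) * 0 + of_nat (Suc k) / z * 0) at_top"
      unfolding Q_def by (intro tendsto_intros lim P)
    moreover have "Q 0 = - fact (Suc k) / z ^ Suc (Suc k)"
      using z by (simp add: Q_def P(3) field_simps)
    ultimately show ?case by (intro exI[of _ Q]) simp
  qed
qed

lemma integrable_power_exp:
  assumes "0 < d" shows "integrable lborel (power_exp k d)"
proof -
  obtain P where P: "\<And>t. (P has_vector_derivative of_real t ^ k * exp (- (complex_of_real d * of_real t))) (at t)"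
       "(P \<longlongrightarrow> 0) at_top"
    using power_times_exp_antiderivative[of "complex_of_real d" k] assms by auto
  have 1: "((\<lambda>t. Re (P t)) has_real_derivative t ^ k * exp (- (d * t))) (at t)" for t
    using bounded_linear.has_vector_derivative[OF bounded_linear_Re P(1)[of t]]
    by (simp add: has_real_derivative_iff_has_vector_derivative exp_of_real flip: of_real_power of_real_mult of_real_minus)
  have 2: "((\<lambda>t. Re (P t)) \<longlongrightarrow> 0) at_top"
    using tendsto_Re[OF P(2)] by simp
  have "(\<integral>\<^sup>+t. ennreal (t ^ k * exp (- (d * t))) * indicator {0..} t \<partial>lborel) = 0 - Re (P 0)"
    by (rule nn_integral_FTC_atLeast[OF _ 1 _ 2]) auto
  moreover have "(\<integral>\<^sup>+t. ennreal (t ^ k * exp (- (d * t))) * indicator {0..} t \<partial>lborel) = (\<integral>\<^sup>+t. ennreal (norm (power_exp k d t)) \<partial>lborel)"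
    by (intro nn_integral_cong) (auto simp: power_exp_def indicator_def)
  ultimately show ?thesis
    by (intro integrableI_bounded) auto
qed

lemma integrable_power_exp_mult:
  fixes f :: "real \<Rightarrow> complex"
  assumes "0 < d" and [measurable]: "f \<in> borel_measurable borel" and "\<And>t. norm (f t) \<le> 1"
  shows "integrable lborel (\<lambda>t. of_real (power_exp k d t) * f t)"
  by (rule Bochner_Integration.integrable_bound[OF integrable_power_exp[OF assms(1), of k]])
     (use assms in \<open>auto simp: norm_mult power_exp_nonneg intro!: mult_left_le\<close>)

text \<open>On the half-line the integrand is t^k e^(-zt) with \<open>z = Complex d x\<close>, so
  the integral up to \<open>y\<close> is \<open>P y - P 0\<close>, which tends to
  \<open>- P 0\<close>. This formula turns oscillation in \<open>t\<close> into decay in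
  \<open>x\<close>.\<close>

lemma integral_power_exp_cis:
  assumes "0 < d"
  shows "(\<integral>t. of_real (power_exp k d t) * cis (- (x * t)) \<partial>lborel) = fact k / (Complex d x) ^ Suc k"
proof -
  define z where "z = Complex d x"
  obtain P where P: "\<And>t. (P has_vector_derivative of_real t ^ k * exp (- (z * of_real t))) (at t)"
       "(P \<longlongrightarrow> 0) at_top" "P 0 = - fact k / z ^ Suc k"
    using power_times_exp_antiderivative[of z k] assms by (auto simp: z_def)
  define f where "f t = of_real (power_exp k d t) * cis (- (x * t))" for t
  have f: "f t = of_real t ^ k * exp (- (z * of_real t))" if "0 \<le> t" for t
  proof -
    have "exp (- (z * of_real t)) = of_real (exp (- (d * t))) * cis (- (x * t))"
      by (simp add: exp_eq_polar z_def)
    thus ?thesis using that by (simp add: f_def power_exp_def)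
  qed
  have int: "integrable lborel f"
    unfolding f_def using assms by (intro integrable_power_exp_mult) (auto simp: cis_conv_exp)
  have "((\<lambda>y. \<integral>t. indicator {..y} t *\<^sub>R f t \<partial>lborel) \<longlongrightarrow> integral\<^sup>L lborel f) at_top"
    by (rule tendsto_integral_at_top[OF _ int]) simp
  moreover have "((\<lambda>y. P y - P 0) \<longlongrightarrow> 0 - P 0) at_top"
    by (intro tendsto_intros P)
  moreover have "\<forall>\<^sub>F y in at_top. P y - P 0 = (\<integral>t. indicator {..y} t *\<^sub>R f t \<partial>lborel)"
    using eventually_ge_at_top[of 0]
  proof eventually_elim
    case (elim y)
    have "(\<integral>t. indicator {0..y} t *\<^sub>R (of_real t ^ k * exp (- (z * of_real t))) \<partial>lborel) = P y - P 0"
      by (rule integral_FTC_Icc[OF elim])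
         (auto intro!: continuous_intros has_vector_derivative_at_within P)
    moreover have "(\<integral>t. indicator {0..y} t *\<^sub>R (of_real t ^ k * exp (- (z * of_real t))) \<partial>lborel)
        = (\<integral>t. indicator {..y} t *\<^sub>R f t \<partial>lborel)"
      by (intro Bochner_Integration.integral_cong)
         (auto simp: f indicator_def, auto simp: f_def power_exp_def)
    ultimately show ?case by simp
  qed
  ultimately have "integral\<^sup>L lborel f = 0 - P 0"
    by (intro tendsto_unique[OF trivial_limit_at_top_linorder _ Lim_transform_eventually])
  thus ?thesis using P(3) by (simp add: f_def[abs_def] z_def)
qed

lemma integral_power_exp:
  assumes "0 < d" shows "integral\<^sup>L lborel (power_exp k d) = fact k / d ^ Suc k"
proof -
  have "complex_of_real (integral\<^sup>L lborel (power_exp k d)) = of_real (fact k / d ^ Suc k)"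
    using integral_power_exp_cis[OF assms, of k 0] by (simp add: complex_of_real_def[symmetric] flip: integral_complex_of_real)
  thus ?thesis by (simp only: of_real_eq_iff)
qed

text \<open>The Cauchy kernel |d + ix|^-2. It dominates the transforms k! / (d + ix)^(k+1) with k >=
  1 up to powers of 1/d, and has total mass pi / d.\<close>

definition lorentz :: "real \<Rightarrow> real \<Rightarrow> real" where "lorentz d x = 1 / (d\<^sup>2 + x\<^sup>2)"

lemma integral_lorentz:
  assumes "0 < d"
  shows "integrable lborel (\<lambda>u. lorentz d (u - a))" "(\<integral>u. lorentz d (u - a) \<partial>lborel) = pi / d"
proof -
  define f where "f t = arctan ((t - a) / d) / d" for t
  have deriv: "(f has_real_derivative lorentz d (t - a)) (at t)" for t
    unfolding f_def lorentz_def using assms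
    by (auto intro!: derivative_eq_intros simp: add_nonneg_eq_0_iff power_divide) (simp add: divide_simps add_nonneg_eq_0_iff power2_eq_square)
  have m [measurable]: "lorentz d \<in> borel_measurable borel" unfolding lorentz_def by measurable
  have cont: "isCont (\<lambda>t. lorentz d (t - a)) t" for t
    unfolding lorentz_def using assms by (intro continuous_intros) (auto simp: add_nonneg_eq_0_iff)
  have lim1: "((f \<circ> real_of_ereal) \<longlongrightarrow> pi / 2 / d) (at_left \<infinity>)"
  proof -
    have "filterlim (\<lambda>t. (t - a) / d) at_top at_top" using assms by real_asymp
    hence "(f \<longlongrightarrow> pi / 2 / d) at_top"
      unfolding f_def by (intro tendsto_intros filterlim_compose[OF tendsto_arctan_at_top]) (use assms in auto)
    thus ?thesis by (simp add: ereal_tendsto_simps1)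
  qed
  have lim2: "((f \<circ> real_of_ereal) \<longlongrightarrow> - (pi / 2) / d) (at_right (- \<infinity>))"
  proof -
    have "filterlim (\<lambda>t. (t - a) / d) at_bot at_bot" using assms by real_asymp
    hence "(f \<longlongrightarrow> - (pi / 2) / d) at_bot"
      unfolding f_def by (intro tendsto_intros filterlim_compose[OF tendsto_arctan_at_bot]) (use assms in auto)
    thus ?thesis by (simp add: ereal_tendsto_simps1)
  qed
  have nn: "0 \<le> lorentz d x" for x by (simp add: lorentz_def)
  have "set_integrable lborel (einterval (-\<infinity>) \<infinity>) (\<lambda>u. lorentz d (u - a))"
       "(LBINT u=-\<infinity>..\<infinity>. lorentz d (u - a)) = pi / 2 / d - (- (pi / 2) / d)"
    using interval_integral_FTC_nonneg[of "-\<infinity>" \<infinity> f "\<lambda>u. lorentz d (u - a)", OF _ deriv cont _ lim2 lim1] nn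
    by auto
  thus "integrable lborel (\<lambda>u. lorentz d (u - a))" "(\<integral>u. lorentz d (u - a) \<partial>lborel) = pi / d"
    by (auto simp: set_integrable_def interval_lebesgue_integral_def set_lebesgue_integral_def einterval_def field_simps)
qed

section \<open>Exchanging Fourier integrals\<close>

lemma measurable_cis [measurable]: "cis \<in> borel_measurable borel"
  by (intro borel_measurable_continuous_onI continuous_intros)

definition fourier :: "(real \<Rightarrow> complex) \<Rightarrow> real \<Rightarrow> complex" where
  "fourier g t = (\<integral>u. g u * cis (- (t * u)) \<partial>lborel)"

lemma integrable_mult_cis:
  fixes g :: "real \<Rightarrow> complex"
  assumes "integrable lborel g"
  shows "integrable lborel (\<lambda>u. g u * cis (a * u))"
proof -
  have [measurable]: "g \<in> borel_measurable borel" using assms by (simp add: borel_measurable_integrable)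
  show ?thesis by (rule Bochner_Integration.integrable_bound[OF assms]) (auto simp: norm_mult)
qed

text \<open>Fubini for the product of two integrable functions with the phase
  \<open>cis (- (t * u))\<close>, which is symmetric in \<open>t\<close> and \<open>u\<close>. It
  allows the integration over \<open>t\<close> to be carried out first.\<close>

lemma integral_fourier_swap:
  fixes h g :: "real \<Rightarrow> complex"
  assumes h: "integrable lborel h" and g: "integrable lborel g"
  shows "(\<integral>t. h t * fourier g t \<partial>lborel) = (\<integral>u. g u * fourier h u \<partial>lborel)"
proof -
  have [measurable]: "g \<in> borel_measurable borel" "h \<in> borel_measurable borel"
    using g h by (simp_all add: borel_measurable_integrable)
  define f where "f = (\<lambda>(t, u). h t * (g u * cis (- (t * u))))"
  have fm [measurable]: "f \<in> borel_measurable (lborel \<Otimes>\<^sub>M lborel)"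
    unfolding f_def by measurable
  have "integrable (lborel \<Otimes>\<^sub>M lborel) f"
  proof (rule lborel_pair.Fubini_integrable[OF fm])
    show "integrable lborel (\<lambda>x. \<integral>y. norm (f (x, y)) \<partial>lborel)"
      using h by (auto simp: f_def norm_mult)
    show "AE x in lborel. integrable lborel (\<lambda>y. f (x, y))"
    proof (rule AE_I2)
      fix x
      show "integrable lborel (\<lambda>y. f (x, y))"
        unfolding f_def using integrable_mult_cis[OF g, of "- x"] by simp
    qed
  qed
  hence i: "integrable (lborel \<Otimes>\<^sub>M lborel) (case_prod (\<lambda>t u. f (t, u)))" by simp
  have "(\<integral>t. h t * fourier g t \<partial>lborel) = (\<integral>t. (\<integral>u. f (t, u) \<partial>lborel) \<partial>lborel)"
    by (simp add: f_def fourier_def)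
  also have "\<dots> = (\<integral>u. (\<integral>t. f (t, u) \<partial>lborel) \<partial>lborel)"
    by (rule lborel_pair.Fubini_integral[OF i, symmetric])
  also have "\<dots> = (\<integral>u. (\<integral>t. g u * (h t * cis (- (u * t))) \<partial>lborel) \<partial>lborel)"
    by (simp add: f_def mult_ac)
  also have "\<dots> = (\<integral>u. g u * fourier h u \<partial>lborel)"
    by (simp add: fourier_def)
  finally show ?thesis .
qed

lemma norm_fourier_le:
  assumes "integrable lborel g"
  shows "norm (fourier g t) \<le> (\<integral>u. norm (g u) \<partial>lborel)"
proof -
  have "norm (fourier g t) \<le> (\<integral>u. norm (g u * cis (- (t * u))) \<partial>lborel)"
    unfolding fourier_def by (rule integral_norm_bound)
  thus ?thesis by (simp add: norm_mult)
qed

lemma continuous_on_fourier: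
  assumes g: "integrable lborel g"
  shows "continuous_on UNIV (fourier g)"
proof -
  have [measurable]: "g \<in> borel_measurable borel" using assms by (simp add: borel_measurable_integrable)
  have "isCont (fourier g) t" for t
    unfolding continuous_at_sequentially comp_def
  proof (intro allI impI)
    fix X assume X: "X \<longlonglongrightarrow> t"
    show "(\<lambda>n. fourier g (X n)) \<longlonglongrightarrow> fourier g t"
      unfolding fourier_def
    proof (rule integral_dominated_convergence[where w = "\<lambda>u. norm (g u)"])
      show "AE u in lborel. (\<lambda>n. g u * cis (- (X n * u))) \<longlonglongrightarrow> g u * cis (- (t * u))"
        by (intro AE_I2 tendsto_intros X)
    qed (use g in \<open>auto simp: norm_mult\<close>)
  qed
  thus ?thesis by (simp add: continuous_on_eq_continuous_at)
qed

section \<open>The zeta function on the critical line\<close>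

text \<open>
  The substitution \<open>x = exp u\<close> turns \<open>\<integral>\<^sub>N\<^sup>\<infinity> {x} x\<^sup>-\<^sup>s\<^sup>-\<^sup>1 dx\<close> into the Fourier transform of
  this function.
\<close>

definition frac_kernel :: "nat \<Rightarrow> real \<Rightarrow> real" where
  "frac_kernel N u = (if ln (real N) \<le> u then frac (exp u) * exp (- u / 2) else 0)"

lemma frac_kernel_measurable [measurable]: "frac_kernel N \<in> borel_measurable borel"
  unfolding frac_kernel_def frac_def by measurable

lemma frac_kernel_nonneg: "0 \<le> frac_kernel N u"
  by (simp add: frac_kernel_def)

text \<open>For u >= ln N one has e^(-u/2) = N^(-1/2) e^(-(u - ln N)/2), so the kernel lies below a
  shifted exponential. This yields both its supremum bound N^(-1/2) and its L1 bound 2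
  N^(-1/2).\<close>

lemma frac_kernel_le_power_exp:
  assumes "1 \<le> N"
  shows "frac_kernel N u \<le> power_exp 0 (1/2) (u - ln (real N)) / sqrt (real N)"
proof (cases "ln (real N) \<le> u")
  case True
  have "exp (- ((u - ln (real N)) / 2)) = exp (- u / 2) * exp (ln (real N) / 2)"
    by (simp add: exp_add[symmetric] field_simps)
  also have "exp (ln (real N) / 2) = sqrt (real N)"
    using assms by (simp add: ln_sqrt[symmetric])
  finally have "power_exp 0 (1/2) (u - ln (real N)) / sqrt (real N) = exp (- u / 2)"
    using True assms by (simp add: power_exp_def)
  moreover have "frac_kernel N u \<le> 1 * exp (- u / 2)"
    unfolding frac_kernel_def using True frac_lt_1[of "exp u"] by (auto intro!: mult_right_mono)
  ultimately show ?thesis by simp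
qed (auto simp: frac_kernel_def power_exp_def)

lemma frac_kernel_le:
  assumes "1 \<le> N" shows "frac_kernel N u \<le> 1 / sqrt (real N)"
proof -
  have "power_exp 0 (1/2) (u - ln (real N)) \<le> 1" by (simp add: power_exp_def)
  hence "power_exp 0 (1/2) (u - ln (real N)) / sqrt (real N) \<le> 1 / sqrt (real N)"
    by (intro divide_right_mono) auto
  thus ?thesis using frac_kernel_le_power_exp[OF assms, of u] by linarith
qed

lemma integrable_frac_kernel:
  assumes "1 \<le> N"
  shows "integrable lborel (frac_kernel N)" "integral\<^sup>L lborel (frac_kernel N) \<le> 2 / sqrt (real N)"
proof -
  have 1: "integrable lborel (\<lambda>u. power_exp 0 (1/2) (u - ln (real N)))"
    using lborel_integrable_real_affine[OF integrable_power_exp[of "1/2" 0], of 1 "- ln (real N)"] by (simp add: add.commute)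
  hence 2: "integrable lborel (\<lambda>u. power_exp 0 (1/2) (u - ln (real N)) / sqrt (real N))" by simp
  have "(\<integral>u. power_exp 0 (1/2) (u - ln (real N)) \<partial>lborel) = 2"
    using lborel_integral_real_affine[of 1 "power_exp 0 (1/2)" "- ln (real N)"] integral_power_exp[of "1/2" 0]
    by (simp add: add.commute)
  hence 3: "(\<integral>u. power_exp 0 (1/2) (u - ln (real N)) / sqrt (real N) \<partial>lborel) = 2 / sqrt (real N)" by simp
  show "integrable lborel (frac_kernel N)"
    by (rule Bochner_Integration.integrable_bound[OF 2])
       (use frac_kernel_le_power_exp[OF assms] in \<open>auto simp: frac_kernel_nonneg power_exp_nonneg\<close>)
  thus "integral\<^sup>L lborel (frac_kernel N) \<le> 2 / sqrt (real N)"
    unfolding 3[symmetric] using 2 frac_kernel_le_power_exp[OF assms] by (intro integral_mono) auto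
qed

definition frac_transform :: "nat \<Rightarrow> real \<Rightarrow> complex" where
  "frac_transform N = fourier (\<lambda>u. of_real (frac_kernel N u))"

lemma norm_frac_transform_le:
  assumes "1 \<le> N" shows "norm (frac_transform N t) \<le> 2 / sqrt (real N)"
  using norm_fourier_le[of "\<lambda>u. of_real (frac_kernel N u)" t] integrable_frac_kernel[OF assms]
  by (simp add: frac_transform_def frac_kernel_nonneg)

section \<open>The powers n^-s for s = 1/2 + it and the Euler-Maclaurin formula for zeta\<close>

definition dirichlet_term :: "real \<Rightarrow> nat \<Rightarrow> complex" where
  "dirichlet_term t n = of_real (1 / sqrt (real n)) * cis (- (t * ln (real n)))"

lemma norm_dirichlet_term: "norm (dirichlet_term t n) = 1 / sqrt (real n)"
  by (simp add: dirichlet_term_def norm_divide)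

lemma dirichlet_term_eq_exp:
  assumes "1 \<le> n" shows "dirichlet_term t n = exp (- Complex (1/2) t * of_real (ln (real n)))"
proof -
  have "exp (- (ln (real n) / 2)) = 1 / sqrt (real n)"
    using assms by (simp add: ln_sqrt[symmetric] exp_minus inverse_eq_divide)
  thus ?thesis by (simp add: exp_eq_polar dirichlet_term_def mult_ac)
qed

lemma dirichlet_term_eq_powr:
  assumes "1 \<le> n" shows "dirichlet_term t n = 1 / of_nat n powr Complex (1/2) t"
proof -
  have "of_nat n powr Complex (1/2) t = exp (Complex (1/2) t * of_real (ln (real n)))"
    using assms by (simp add: powr_def Ln_of_nat)
  thus ?thesis using assms by (simp add: dirichlet_term_eq_exp exp_minus inverse_eq_divide)
qed

lemma dirichlet_term_mult: "1 \<le> m \<Longrightarrow> 1 \<le> n \<Longrightarrow> dirichlet_term t (m * n) = dirichlet_term t m * dirichlet_term t n"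
  by (simp add: dirichlet_term_eq_exp ln_mult ring_distribs mult_exp_exp)

lemma of_nat_mult_dirichlet_term_eq_exp:
  assumes "1 \<le> n" shows "of_nat n * dirichlet_term t n = exp ((1 - Complex (1/2) t) * of_real (ln (real n)))"
proof -
  have "of_nat n = exp (complex_of_real (ln (real n)))" using assms
    by (simp add: exp_of_real)
  thus ?thesis using assms by (simp add: dirichlet_term_eq_exp mult_exp_exp algebra_simps)
qed

definition dirichlet_sum :: "nat \<Rightarrow> real \<Rightarrow> complex" where
  "dirichlet_sum N t = (\<Sum>n=1..N. dirichlet_term t n)"

text \<open>This is N^(1-s) / (1 - s), the term that comes from the pole of zeta at 1.\<close>

definition polar_term :: "nat \<Rightarrow> real \<Rightarrow> complex" where
  "polar_term N t = of_nat N * dirichlet_term t N / (1 - Complex (1/2) t)"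

text \<open>One step of Euler-Maclaurin summation: between ln N and ln (N+1) the fractional part of
  e^u is e^u - N, so the two transforms differ by an elementary integral with antiderivative
  \<open>Q\<close>.\<close>

lemma frac_transform_diff:
  assumes N: "1 \<le> N"
  defines "s \<equiv> \<lambda>t. Complex (1/2) t"
  shows "s t * (frac_transform N t - frac_transform (Suc N) t) = polar_term (Suc N) t - polar_term N t - dirichlet_term t (Suc N)"
proof -
  define s' where "s' = Complex (1/2) t"
  have s0: "s' \<noteq> 0" "1 - s' \<noteq> 0" by (auto simp: s'_def complex_eq_iff)
  define a b where "a = ln (real N)" and "b = ln (real (Suc N))"
  have ab: "a \<le> b" unfolding a_def b_def using N by simp
  define f where "f u = (exp ((1 - s') * of_real u) - of_nat N * exp (- s' * of_real u))" for u
  define Q where "Q u = exp ((1 - s') * of_real u) / (1 - s') + of_nat N * exp (- s' * of_real u) / s'" for u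
  have i: "integrable lborel (\<lambda>u. of_real (frac_kernel M u) * cis (- (t * u)))" if "1 \<le> M" for M
    using integrable_mult_cis[of "\<lambda>u. of_real (frac_kernel M u)" "- t"] integrable_frac_kernel(1)[OF that] by simp
  have "frac_transform N t - frac_transform (Suc N) t = (\<integral>u. of_real (frac_kernel N u) * cis (- (t * u)) - of_real (frac_kernel (Suc N) u) * cis (- (t * u)) \<partial>lborel)"
    unfolding frac_transform_def fourier_def using i N by (intro Bochner_Integration.integral_diff[symmetric]) auto
  also have "\<dots> = (\<integral>u. indicator {a..b} u *\<^sub>R f u \<partial>lborel)"
  proof (rule integral_cong_AE)
    \<comment> \<open>At \<open>u = b\<close> the fractional part has already dropped to 0 while
      \<open>f\<close> has not; this single point is discarded as a null set.\<close>
    have "AE u in lborel. u \<noteq> b" by (rule AE_lborel_singleton)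
    thus "AE u in lborel. of_real (frac_kernel N u) * cis (- (t * u)) - of_real (frac_kernel (Suc N) u) * cis (- (t * u)) = indicator {a..b} u *\<^sub>R f u"
    proof eventually_elim
      case (elim u)
      consider "u < a" | "a \<le> u" "u < b" | "b < u" using elim by linarith
      thus ?case
      proof cases
        case 2
        have "real N \<le> exp u" using 2(1) N unfolding a_def
          using exp_le_cancel_iff[of "ln (real N)" u] by simp
        moreover have "exp u < real (Suc N)" using 2(2) unfolding b_def
          using exp_less_cancel_iff[of u "ln (real (Suc N))"] by simp
        ultimately have "\<lfloor>exp u\<rfloor> = int N" by (intro floor_unique) auto
        hence 3: "frac_kernel N u = (exp u - real N) * exp (- u / 2)" "frac_kernel (Suc N) u = 0"
          using 2 by (auto simp: frac_kernel_def a_def b_def frac_def)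
        have 4: "exp (- s' * of_real u) = of_real (exp (- u / 2)) * cis (- (t * u))"
          by (simp add: exp_eq_polar s'_def)
        have 5: "exp ((1 - s') * of_real u) = of_real (exp u) * exp (- s' * of_real u)"
          by (simp add: mult_exp_exp algebra_simps flip: exp_of_real)
        show ?thesis using 2 unfolding f_def 5 4 3 by (simp add: algebra_simps)
      next
        case 1
        hence "frac_kernel N u = 0" "frac_kernel (Suc N) u = 0" "u \<notin> {a..b}"
          using ab unfolding frac_kernel_def a_def[symmetric] b_def[symmetric] by simp_all
        thus ?thesis by simp
      next
        case 3
        hence "frac_kernel N u = frac_kernel (Suc N) u" "u \<notin> {a..b}"
          using ab unfolding frac_kernel_def a_def[symmetric] b_def[symmetric] by simp_all
        thus ?thesis by simp
      qed
    qed
  qed (auto simp: f_def)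
  also have "\<dots> = Q b - Q a"
  proof (rule integral_FTC_Icc[OF ab])
    show "(Q has_vector_derivative f x) (at x within {a..b})" for x
    proof -
      have D: "((\<lambda>u. exp (c * of_real u)) has_vector_derivative c * exp (c * of_real x)) (at x within {a..b})" for c :: complex
        by (intro has_vector_derivative_real_field) (auto intro!: derivative_eq_intros)
      have "(Q has_vector_derivative (1 / (1 - s')) * ((1 - s') * exp ((1 - s') * of_real x))
          + (of_nat N / s') * (- s' * exp (- s' * of_real x))) (at x within {a..b})"
        using has_vector_derivative_add[OF has_vector_derivative_mult_right[OF D[of "1 - s'"], of "1 / (1 - s')"]
          has_vector_derivative_mult_right[OF D[of "- s'"], of "of_nat N / s'"]]
        by (simp add: Q_def[abs_def])
      thus ?thesis using s0 by (simp add: f_def)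
    qed
    show "continuous_on {a..b} f" unfolding f_def by (intro continuous_intros)
  qed
  finally have 1: "frac_transform N t - frac_transform (Suc N) t = Q b - Q a" .
  have 2: "Q b = of_nat (Suc N) * dirichlet_term t (Suc N) / (1 - s') + of_nat N * dirichlet_term t (Suc N) / s'"
    using of_nat_mult_dirichlet_term_eq_exp[of "Suc N" t] dirichlet_term_eq_exp[of "Suc N" t] by (simp add: Q_def b_def s'_def)
  have 3: "Q a = of_nat N * dirichlet_term t N / (1 - s') + of_nat N * dirichlet_term t N / s'"
    using of_nat_mult_dirichlet_term_eq_exp[of N t] dirichlet_term_eq_exp[of N t] N by (simp add: Q_def a_def s'_def)
  show ?thesis unfolding 1 2 3 polar_term_def s_def s'_def[symmetric] using s0
    by (simp add: divide_simps) (simp add: algebra_simps)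
qed

definition approx_zeta :: "nat \<Rightarrow> real \<Rightarrow> complex" where
  "approx_zeta N t = dirichlet_sum N t - polar_term N t - Complex (1/2) t * frac_transform N t"

text \<open>By \<open>frac_transform_diff\<close> the increments of the three terms cancel.
  Independence of \<open>N\<close> lets the same value be compared with the eta series as
  \<open>N\<close> grows, and later be used with \<open>N\<close> adapted to
  \<open>d\<close>.\<close>

lemma approx_zeta_const:
  assumes "1 \<le> N" shows "approx_zeta N t = approx_zeta 1 t"
  using assms
proof (induction N rule: dec_induct)
  case (step N)
  have "approx_zeta (Suc N) t = approx_zeta N t"
    using frac_transform_diff[of N t] step by (simp add: approx_zeta_def dirichlet_sum_def algebra_simps)
  with step show ?case by simp
qed simp

text \<open>The finite form of eta(s) = (1 - 2^(1-s)) zeta(s): the alternating sum is the full sum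
  minus twice its even-indexed terms, and (2m)^-s = 2^-s m^-s.\<close>

lemma alternating_sum_eq_dirichlet_sum:
  "(\<Sum>n<2*M. (-1) ^ n / of_nat (Suc n) powr Complex (1/2) t) = dirichlet_sum (2*M) t - 2 * dirichlet_term t 2 * dirichlet_sum M t"
proof (induction M)
  case (Suc M)
  have 2: "2 * Suc M = Suc (Suc (2 * M))" by simp
  have "dirichlet_term t (Suc (Suc (2*M))) = dirichlet_term t 2 * dirichlet_term t (Suc M)"
    using dirichlet_term_mult[of 2 "Suc M" t] by simp
  hence "dirichlet_sum (2 * Suc M) t - 2 * dirichlet_term t 2 * dirichlet_sum (Suc M) t
     = (dirichlet_sum (2*M) t - 2 * dirichlet_term t 2 * dirichlet_sum M t) + dirichlet_term t (Suc (2*M)) - dirichlet_term t (Suc (Suc (2*M)))"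
    unfolding 2 dirichlet_sum_def by (simp add: algebra_simps)
  also have "\<dots> = (\<Sum>n<2*Suc M. (-1) ^ n / of_nat (Suc n) powr Complex (1/2) t)"
    unfolding Suc[symmetric] 2 using dirichlet_term_eq_powr[of "Suc (2*M)" t] dirichlet_term_eq_powr[of "Suc (Suc (2*M))" t] by simp
  finally show ?case by simp
qed (simp add: dirichlet_sum_def)

lemma frac_transform_tendsto_0: "(\<lambda>N. frac_transform N t) \<longlonglongrightarrow> 0"
proof (rule Lim_null_comparison)
  show "\<forall>\<^sub>F N in sequentially. norm (frac_transform N t) \<le> 2 / sqrt (real N)"
    using eventually_ge_at_top[of 1] by eventually_elim (rule norm_frac_transform_le)
  show "(\<lambda>N. 2 / sqrt (real N)) \<longlonglongrightarrow> 0" by real_asymp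
qed

text \<open>With c = 2^(1-s), the alternating sum up to 2M equals (1 - c) Y plus s times a
  combination of \<open>frac_transform\<close> values, which tends to 0. Dividing by 1 - c recovers
  the definition of \<open>zeta_crit\<close>.\<close>

lemma zeta_crit_eq_approx:
  assumes "1 \<le> N"
  shows "zeta_crit t = dirichlet_sum N t - polar_term N t - Complex (1/2) t * frac_transform N t"
proof -
  define s where "s = Complex (1/2) t"
  define f where "f n = (-1) ^ n / of_nat (Suc n) powr s" for n :: nat
  define Y where "Y = approx_zeta 1 t"
  define c where "c = 2 * dirichlet_term t 2"
  have Y: "dirichlet_sum M t = Y + polar_term M t + s * frac_transform M t" if "1 \<le> M" for M
    using approx_zeta_const[OF that, of t] by (simp add: Y_def approx_zeta_def s_def algebra_simps)
  have ev: "(\<lambda>M. sum f {..<2*M}) \<longlonglongrightarrow> (1 - c) * Y"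
  proof (rule Lim_transform_eventually)
    have "(\<lambda>M. frac_transform (2 * M) t) \<longlonglongrightarrow> 0"
      by (rule filterlim_compose[OF frac_transform_tendsto_0]) (simp add: filterlim_subseq strict_mono_def)
    from tendsto_add[OF tendsto_const[of "(1 - c) * Y"] tendsto_mult_left[OF tendsto_diff[OF this tendsto_mult_left[OF frac_transform_tendsto_0[of t], of c]], of s]]
    show "(\<lambda>M. (1 - c) * Y + s * (frac_transform (2 * M) t - c * frac_transform M t)) \<longlonglongrightarrow> (1 - c) * Y" by simp
    show "\<forall>\<^sub>F M in sequentially. (1 - c) * Y + s * (frac_transform (2 * M) t - c * frac_transform M t) = sum f {..<2*M}"
      using eventually_ge_at_top[of 1]
    proof eventually_elim
      case (elim M)
      \<comment> \<open>The divergent polar terms of the two Dirichlet sums cancel exactly.\<close>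
      have "polar_term (2 * M) t = c * polar_term M t"
        using dirichlet_term_mult[of 2 M t] elim by (simp add: polar_term_def c_def)
      thus ?case
        using elim unfolding f_def s_def alternating_sum_eq_dirichlet_sum Y[OF elim] c_def[symmetric]
        by (subst Y) (auto simp: s_def algebra_simps)
    qed
  qed
  have f0: "f \<longlonglongrightarrow> 0"
  proof (rule tendsto_norm_zero_cancel)
    have "norm (f n) = 1 / sqrt (real (Suc n))" for n
      using norm_dirichlet_term[of t "Suc n"] dirichlet_term_eq_powr[of "Suc n" t] by (simp add: f_def s_def norm_divide norm_power)
    moreover have "(\<lambda>n. 1 / sqrt (real (Suc n))) \<longlonglongrightarrow> 0" by real_asymp
    ultimately show "(\<lambda>n. norm (f n)) \<longlonglongrightarrow> 0" by simp
  qed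
  \<comment> \<open>Odd partial sums differ from even ones by a single term of modulus tending to
    0.\<close>
  have od: "(\<lambda>M. sum f {..<Suc (2*M)}) \<longlonglongrightarrow> (1 - c) * Y"
  proof -
    have "(\<lambda>M. f (2 * M)) \<longlonglongrightarrow> 0"
      by (rule filterlim_compose[OF f0]) (simp add: filterlim_subseq strict_mono_def)
    from tendsto_add[OF ev this] show ?thesis by simp
  qed
  have "(\<lambda>n. sum f {..<n}) \<longlonglongrightarrow> (1 - c) * Y"
    by (rule limseq_even_odd) (use ev od in simp_all)
  hence "suminf f = (1 - c) * Y"
    by (simp add: sums_def sums_unique[symmetric])
  moreover have "c = 2 powr (1 - s)"
    using dirichlet_term_eq_powr[of 2 t] by (simp add: c_def s_def powr_diff)
  \<comment> \<open>The modulus of \<open>c\<close> is 2 / sqrt 2, which is not 1.\<close>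
  moreover have "c \<noteq> 1"
  proof
    assume "c = 1"
    hence "norm c = 1" by simp
    hence "2 / sqrt 2 = (1::real)" by (simp add: c_def norm_mult norm_dirichlet_term)
    hence "sqrt 2 = 2" by (simp add: field_simps)
    hence "(sqrt 2)\<^sup>2 = 4" by simp
    thus False by simp
  qed
  ultimately have "zeta_crit t = Y"
    by (simp add: zeta_crit_def Let_def s_def f_def[abs_def])
  thus ?thesis using Y[OF assms] by (simp add: s_def algebra_simps)
qed

section \<open>The weighted second moment\<close>

text \<open>Telescoping: 1 / sqrt (n+1) is at most 2 (sqrt (n+1) - sqrt n), because the difference
  of roots times their sum is 1.\<close>

lemma sum_inverse_sqrt_le: "(\<Sum>n=1..N. 1 / sqrt (real n)) \<le> 2 * sqrt (real N)"
proof (induction N)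
  case (Suc N)
  define a b where "a = sqrt (real N)" and "b = sqrt (real (Suc N))"
  have "a \<le> b" "0 \<le> a" "0 < b" by (auto simp: a_def b_def)
  moreover have "(b - a) * (b + a) = 1" by (simp add: a_def b_def algebra_simps)
  moreover have "(b - a) * (b + a) \<le> (b - a) * (2 * b)"
    using \<open>a \<le> b\<close> by (intro mult_left_mono) auto
  ultimately have "1 / b \<le> 2 * b - 2 * a"
    by (simp add: divide_simps) (simp add: algebra_simps)
  thus ?case using Suc by (simp add: a_def b_def)
qed simp

lemma norm_integral_le:
  fixes f :: "real \<Rightarrow> 'a::{banach, second_countable_topology}"
  assumes "integrable lborel g" "\<And>x. norm (f x) \<le> g x"
  shows "norm (integral\<^sup>L lborel f) \<le> integral\<^sup>L lborel g"
proof (cases "integrable lborel f")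
  case True
  show ?thesis by (rule Bochner_Integration.integral_norm_bound_integral[OF True assms(1)]) (use assms(2) in auto)
next
  \<comment> \<open>A non-integrable function has Bochner integral 0 by default, and
    \<open>g\<close> is nonnegative since it bounds a norm.\<close>
  case False
  have "0 \<le> g x" for x using assms(2)[of x] norm_ge_zero order.trans by blast
  thus ?thesis using False by (simp add: not_integrable_integral_eq)
qed

section \<open>Weights carrying the factors s and |s|^2, and their transforms\<close>

lemma norm_Complex_power2: "norm (Complex d x) ^ 2 = 1 / lorentz d x" 
  by (simp add: cmod_power2 lorentz_def)

lemma lorentz_pos: "0 < d \<Longrightarrow> 0 < lorentz d x"
  by (simp add: lorentz_def add_pos_nonneg)

lemma lorentz_le: "0 < d \<Longrightarrow> lorentz d x \<le> 1 / d\<^sup>2"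
  by (simp add: lorentz_def frac_le)

lemma power_exp_mult: "t * power_exp k d t = power_exp (Suc k) d t"
  by (simp add: power_exp_def)

text \<open>The factor s in front of \<open>frac_transform\<close> is absorbed into the weight, so
  that its growth in \<open>t\<close> is seen by the transform as one more power of 1 / (d +
  ix).\<close>

definition weight_s :: "real \<Rightarrow> real \<Rightarrow> complex" where
  "weight_s d t = of_real (power_exp 1 d t) * Complex (1/2) t"

definition weight_s2 :: "real \<Rightarrow> real \<Rightarrow> complex" where
  "weight_s2 d t = of_real (power_exp 1 d t * (norm (Complex (1/2) t))\<^sup>2)"

lemma weight_s_altdef: "weight_s d t = of_real (power_exp 1 d t) / 2 + \<i> * of_real (power_exp 2 d t)"
  by (simp add: weight_s_def Complex_eq algebra_simps numeral_2_eq_2 flip: power_exp_mult)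

lemma weight_s2_altdef: "weight_s2 d t = of_real (power_exp 1 d t) / 4 + of_real (power_exp 3 d t)"
proof -
  have "power_exp 3 d t = t\<^sup>2 * power_exp 1 d t" by (simp add: power_exp_def power3_eq_cube power2_eq_square)
  thus ?thesis by (simp add: weight_s2_def cmod_power2 algebra_simps power_divide)
qed

lemma integrable_complex_power_exp: "0 < d \<Longrightarrow> integrable lborel (\<lambda>t. complex_of_real (power_exp k d t))"
  using integrable_power_exp by simp

lemma integrable_weight_s: "0 < d \<Longrightarrow> integrable lborel (weight_s d)"
  unfolding weight_s_altdef[abs_def] using integrable_complex_power_exp by simp

lemma integrable_weight_s2: "0 < d \<Longrightarrow> integrable lborel (weight_s2 d)"
  unfolding weight_s2_altdef[abs_def] using integrable_complex_power_exp by simp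

lemma fourier_power_exp: "0 < d \<Longrightarrow> fourier (\<lambda>t. of_real (power_exp k d t)) x = fact k / (Complex d x) ^ Suc k"
  unfolding fourier_def by (rule integral_power_exp_cis)

lemma fourier_add:
  assumes "integrable lborel f" "integrable lborel g"
  shows "fourier (\<lambda>t. f t + g t) x = fourier f x + fourier g x"
  unfolding fourier_def using integrable_mult_cis[OF assms(1), of "-x"] integrable_mult_cis[OF assms(2), of "-x"]
  by (simp add: ring_distribs)

lemma fourier_cmult: "fourier (\<lambda>t. c * f t) x = c * fourier f x"
  unfolding fourier_def by (simp add: mult.assoc)

lemma fourier_cdivide: "fourier (\<lambda>t. f t / c) x = fourier f x / c"
  unfolding fourier_def by (simp add: field_simps flip: integral_divide_zero)

text \<open>With z = d + ix the transform is 1 / (2 z^2) + 2i / z^3. Two powers of 1 / |z| form the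
  Lorentz kernel and the spare one is at most 1/d. As 1/2 is at most 1/d, the constant is 1 +
  2.\<close>

lemma norm_fourier_weight_s:
  assumes "0 < d" "d \<le> 1" shows "norm (fourier (weight_s d) x) \<le> 3 / d * lorentz d x"
proof -
  define z where "z = Complex d x"
  define l where "l = lorentz d x"
  have z: "norm z ^ 2 = 1 / l" unfolding z_def l_def by (rule norm_Complex_power2)
  have l: "0 < l" unfolding l_def using assms lorentz_pos by simp
  have dz: "d \<le> norm z" using complex_Re_le_cmod[of z] by (simp add: z_def)
  have "fourier (weight_s d) x = (1/2) * (1 / z ^ 2) + \<i> * (2 / z ^ 3)"
  proof -
    have "weight_s d = (\<lambda>t. (1/2) * of_real (power_exp 1 d t) + \<i> * of_real (power_exp 2 d t))"
      by (auto simp: weight_s_altdef)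
    thus ?thesis using assms integrable_complex_power_exp[of d]
      by (simp add: fourier_add fourier_cmult fourier_cdivide fourier_power_exp z_def fact_numeral numeral_3_eq_3 numeral_2_eq_2)
  qed
  also have "norm \<dots> \<le> (1/2) * (1 / norm z ^ 2) + 2 / norm z ^ 3"
    by (rule order.trans[OF norm_triangle_ineq]) (simp add: norm_mult norm_divide norm_power)
  also have "2 / norm z ^ 3 = 2 / norm z * (1 / norm z ^ 2)" by (simp add: power3_eq_cube power2_eq_square)
  also have "(1/2) * (1 / norm z ^ 2) + 2 / norm z * (1 / norm z ^ 2) = (1/2 + 2 / norm z) * l"
    unfolding z by (simp add: algebra_simps)
  also have "\<dots> \<le> (1 / d + 2 / d) * l"
    using assms l dz by (intro mult_right_mono add_mono divide_left_mono mult_pos_pos) (auto simp: field_simps)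
  finally show ?thesis by (simp add: l_def)
qed

text \<open>The transform is 1 / (4 z^2) + 6 / z^4. One Lorentz factor is kept and the other is
  bounded by 1 / d^2; the constant is 1 + 6.\<close>

lemma norm_fourier_weight_s2:
  assumes "0 < d" "d \<le> 1" shows "norm (fourier (weight_s2 d) x) \<le> 7 / d\<^sup>2 * lorentz d x"
proof -
  define z where "z = Complex d x"
  define l where "l = lorentz d x"
  have z: "norm z ^ 2 = 1 / l" unfolding z_def l_def by (rule norm_Complex_power2)
  have l: "0 < l" "l \<le> 1 / d\<^sup>2" unfolding l_def using assms lorentz_pos lorentz_le by simp_all
  have "fourier (weight_s2 d) x = (1/4) * (1 / z ^ 2) + 6 / z ^ 4"
  proof -
    have "weight_s2 d = (\<lambda>t. (1/4) * of_real (power_exp 1 d t) + of_real (power_exp 3 d t))"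
      by (auto simp: weight_s2_altdef)
    thus ?thesis using assms integrable_complex_power_exp[of d]
      by (simp add: fourier_add fourier_cmult fourier_cdivide fourier_power_exp z_def fact_numeral eval_nat_numeral)
  qed
  also have "norm \<dots> \<le> (1/4) * (1 / norm z ^ 2) + 6 / norm z ^ 4"
    by (rule order.trans[OF norm_triangle_ineq]) (simp add: norm_mult norm_divide norm_power)
  also have "6 / norm z ^ 4 = 6 * (1 / norm z ^ 2) * (1 / norm z ^ 2)" by (simp add: eval_nat_numeral)
  also have "(1/4) * (1 / norm z ^ 2) + 6 * (1 / norm z ^ 2) * (1 / norm z ^ 2) = (1/4 + 6 * l) * l"
    unfolding z by (simp add: algebra_simps)
  also have "\<dots> \<le> (1 / d\<^sup>2 + 6 * (1 / d\<^sup>2)) * l"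
  proof (intro mult_right_mono add_mono mult_left_mono)
    have "d\<^sup>2 \<le> 1" using assms by (simp add: power_le_one)
    thus "1 / 4 \<le> 1 / d\<^sup>2" using assms by (simp add: field_simps)
  qed (use l in auto)
  finally show ?thesis by (simp add: l_def)
qed

lemma fourier_shift: "fourier (\<lambda>t. f t * cis (a * t)) u = fourier f (u - a)"
  unfolding fourier_def by (intro Bochner_Integration.integral_cong refl) (simp add: mult.assoc cis_mult algebra_simps)

lemma fourier_sum:
  assumes "\<And>n. n \<in> A \<Longrightarrow> integrable lborel (f n)"
  shows "fourier (\<lambda>t. \<Sum>n\<in>A. f n t) x = (\<Sum>n\<in>A. fourier (f n) x)"
  unfolding fourier_def sum_distrib_right
  using integrable_mult_cis[OF assms, of _ "- x"] by (intro Bochner_Integration.integral_sum) simp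

section \<open>Mixed and quadratic contributions of the remainder\<close>

lemma cnj_dirichlet_sum: "cnj (dirichlet_sum N t) = (\<Sum>n=1..N. of_real (1 / sqrt (real n)) * cis (ln (real n) * t))"
  by (simp add: dirichlet_sum_def dirichlet_term_def cis_cnj mult.commute)

text \<open>Absolute values at each \<open>t\<close> would only give order d^-3. After the swap each
  \<open>n\<close> contributes a Lorentz kernel centred at ln n, of mass pi / d; the kernel bound
  N^(-1/2) then cancels against the sum of n^(-1/2), which is at most 2 sqrt N.\<close>

lemma cross_term_bound:
  assumes d: "0 < d" "d \<le> 1" and N: "1 \<le> N"
  shows "norm (\<integral>t. of_real (power_exp 1 d t) * cnj (dirichlet_sum N t) * (Complex (1/2) t * frac_transform N t) \<partial>lborel) \<le> 6 * pi / d\<^sup>2"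
proof -
  define h where "h t = (\<Sum>n=1..N. of_real (1 / sqrt (real n)) * (weight_s d t * cis (ln (real n) * t)))" for t
  have hn: "integrable lborel (\<lambda>t. of_real (1 / sqrt (real n)) * (weight_s d t * cis (ln (real n) * t)))" for n
    using integrable_mult_cis[OF integrable_weight_s[OF d(1)]] by simp
  have h: "integrable lborel h"
    unfolding h_def using hn by (intro Bochner_Integration.integrable_sum)
  have g: "integrable lborel (\<lambda>u. complex_of_real (frac_kernel N u))" using integrable_frac_kernel(1)[OF N] by simp
  have "(\<integral>t. of_real (power_exp 1 d t) * cnj (dirichlet_sum N t) * (Complex (1/2) t * frac_transform N t) \<partial>lborel) = (\<integral>t. h t * fourier (\<lambda>u. complex_of_real (frac_kernel N u)) t \<partial>lborel)"
    unfolding h_def cnj_dirichlet_sum frac_transform_def weight_s_def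
    by (intro Bochner_Integration.integral_cong refl) (simp add: sum_distrib_left sum_distrib_right mult_ac)
  also have "\<dots> = (\<integral>u. complex_of_real (frac_kernel N u) * fourier h u \<partial>lborel)"
    by (rule integral_fourier_swap[OF h g])
  also have "norm \<dots> \<le> (\<integral>u. (\<Sum>n=1..N. 1 / sqrt (real n) * (1 / sqrt (real N) * (3 / d * lorentz d (u - ln (real n))))) \<partial>lborel)"
  proof (rule norm_integral_le)
    show "integrable lborel (\<lambda>u. \<Sum>n=1..N. 1 / sqrt (real n) * (1 / sqrt (real N) * (3 / d * lorentz d (u - ln (real n)))))"
      using integral_lorentz(1)[OF d(1)] by (intro Bochner_Integration.integrable_sum integrable_mult_right) auto
    fix u
    have "fourier h u = (\<Sum>n=1..N. of_real (1 / sqrt (real n)) * fourier (weight_s d) (u - ln (real n)))"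
      unfolding h_def using hn by (simp add: fourier_sum fourier_cmult fourier_shift fourier_cdivide)
    hence "norm (fourier h u) \<le> (\<Sum>n=1..N. norm (of_real (1 / sqrt (real n)) * fourier (weight_s d) (u - ln (real n))))"
      by (simp only: norm_sum)
    also have "\<dots> \<le> (\<Sum>n=1..N. 1 / sqrt (real n) * (3 / d * lorentz d (u - ln (real n))))"
      unfolding norm_mult
      using norm_fourier_weight_s[OF d] by (intro sum_mono mult_mono) (auto simp: norm_divide)
    finally have "norm (of_real (frac_kernel N u) * fourier h u) \<le> 1 / sqrt (real N) * (\<Sum>n=1..N. 1 / sqrt (real n) * (3 / d * lorentz d (u - ln (real n))))"
      unfolding norm_mult using frac_kernel_le[OF N, of u] frac_kernel_nonneg[of N u] by (intro mult_mono) auto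
    thus "norm (of_real (frac_kernel N u) * fourier h u) \<le> (\<Sum>n=1..N. 1 / sqrt (real n) * (1 / sqrt (real N) * (3 / d * lorentz d (u - ln (real n)))))"
      by (simp add: sum_distrib_left mult_ac)
  qed
  also have "\<dots> = (\<Sum>n=1..N. 1 / sqrt (real n) * (1 / sqrt (real N) * (3 / d * (pi / d))))"
    using integral_lorentz[OF d(1)] by (simp add: mult_ac)
  also have "\<dots> = (\<Sum>n=1..N. 1 / sqrt (real n)) * (1 / sqrt (real N) * (3 / d * (pi / d)))"
    by (rule sum_distrib_right[symmetric])
  also have "\<dots> \<le> (2 * sqrt (real N)) * (1 / sqrt (real N) * (3 / d * (pi / d)))"
    using sum_inverse_sqrt_le d by (intro mult_right_mono) auto
  also have "\<dots> = 6 * pi / d\<^sup>2" using N by (simp add: power2_eq_square)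
  finally show ?thesis .
qed

lemma frac_transform_measurable: "1 \<le> N \<Longrightarrow> frac_transform N \<in> borel_measurable borel"
  unfolding frac_transform_def using integrable_frac_kernel(1)
  by (intro borel_measurable_continuous_onI continuous_on_fourier) simp

text \<open>The swap is applied twice, once for each factor \<open>frac_transform\<close>. One
  kernel is measured by its supremum N^(-1/2) and the other by its L1 norm 2 N^(-1/2), which
  produces the 1/N; for N of size 1/d the bound is of order d^-2.\<close>

lemma error_term_bound:
  assumes d: "0 < d" "d \<le> 1" and N: "1 \<le> N"
  shows "norm (\<integral>t. weight_s2 d t * (cnj (frac_transform N t) * frac_transform N t) \<partial>lborel) \<le> 14 * pi / (d ^ 3 * real N)"
proof -
  note [measurable] = frac_transform_measurable[OF N]
  have g: "integrable lborel (\<lambda>u. complex_of_real (frac_kernel N u))" using integrable_frac_kernel(1)[OF N] by simp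
  have [measurable]: "(\<lambda>t. cnj (frac_transform N t)) \<in> borel_measurable borel"
    by (rule measurable_compose[OF frac_transform_measurable[OF N]]) (intro borel_measurable_continuous_onI continuous_intros)
  define h where "h t = weight_s2 d t * cnj (frac_transform N t)" for t
  have [measurable]: "weight_s2 d \<in> borel_measurable borel"
    using integrable_weight_s2[OF d(1)] by (simp add: borel_measurable_integrable)
  have N1: "2 / sqrt (real N) \<le> 2" using N by (simp add: divide_le_eq)
  have h: "integrable lborel h"
  proof (rule Bochner_Integration.integrable_bound)
    show "integrable lborel (\<lambda>t. 2 * weight_s2 d t)" using integrable_weight_s2[OF d(1)] by simp
    show "h \<in> borel_measurable lborel" unfolding h_def by measurable
    have "norm (h t) \<le> norm (weight_s2 d t) * 2" for t
      unfolding h_def norm_mult using norm_frac_transform_le[OF N, of t] N1 by (intro mult_left_mono) auto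
    thus "AE t in lborel. norm (h t) \<le> norm (2 * weight_s2 d t)" by (simp add: norm_mult mult.commute)
  qed
  have H: "norm (fourier h u) \<le> 1 / sqrt (real N) * (7 / d\<^sup>2 * (pi / d))" for u
  proof -
    \<comment> \<open>As the weight is real, conjugation moves the bar off
      \<open>frac_transform\<close>, so that the swap applies to the inner integral too.\<close>
    have "fourier h u = (\<integral>t. cnj (weight_s2 d t * cis (u * t) * frac_transform N t) \<partial>lborel)"
      unfolding fourier_def h_def by (simp add: weight_s2_def cis_cnj mult_ac)
    also have "\<dots> = cnj (\<integral>t. (weight_s2 d t * cis (u * t)) * fourier (\<lambda>u. of_real (frac_kernel N u)) t \<partial>lborel)"
      unfolding frac_transform_def by (rule Bochner_Integration.integral_cnj)
    also have "(\<integral>t. (weight_s2 d t * cis (u * t)) * fourier (\<lambda>u. of_real (frac_kernel N u)) t \<partial>lborel) =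
        (\<integral>v. of_real (frac_kernel N v) * fourier (weight_s2 d) (v - u) \<partial>lborel)"
      using integral_fourier_swap[OF integrable_mult_cis[OF integrable_weight_s2[OF d(1)]] g, of u] by (simp add: fourier_shift)
    finally have "norm (fourier h u) = norm (\<integral>v. of_real (frac_kernel N v) * fourier (weight_s2 d) (v - u) \<partial>lborel)" by simp
    also have "\<dots> \<le> (\<integral>v. 1 / sqrt (real N) * (7 / d\<^sup>2 * lorentz d (v - u)) \<partial>lborel)"
    proof (rule norm_integral_le)
      show "integrable lborel (\<lambda>v. 1 / sqrt (real N) * (7 / d\<^sup>2 * lorentz d (v - u)))"
        using integral_lorentz(1)[OF d(1)] by (intro integrable_mult_right) auto
      show "norm (of_real (frac_kernel N v) * fourier (weight_s2 d) (v - u)) \<le> 1 / sqrt (real N) * (7 / d\<^sup>2 * lorentz d (v - u))" for v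
        unfolding norm_mult using frac_kernel_le[OF N, of v] frac_kernel_nonneg[of N v] norm_fourier_weight_s2[OF d] by (intro mult_mono) auto
    qed
    also have "\<dots> = 1 / sqrt (real N) * (7 / d\<^sup>2 * (pi / d))"
      using integral_lorentz[OF d(1)] by simp
    finally show ?thesis .
  qed
  have "(\<integral>t. weight_s2 d t * (cnj (frac_transform N t) * frac_transform N t) \<partial>lborel) = (\<integral>u. of_real (frac_kernel N u) * fourier h u \<partial>lborel)"
    using integral_fourier_swap[OF h g] by (simp add: h_def mult_ac frac_transform_def)
  also have "norm \<dots> \<le> (\<integral>u. frac_kernel N u * (1 / sqrt (real N) * (7 / d\<^sup>2 * (pi / d))) \<partial>lborel)"
  proof (rule norm_integral_le)
    show "integrable lborel (\<lambda>u. frac_kernel N u * (1 / sqrt (real N) * (7 / d\<^sup>2 * (pi / d))))"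
      using integrable_frac_kernel(1)[OF N] by (rule integrable_mult_left)
    show "norm (of_real (frac_kernel N u) * fourier h u) \<le> frac_kernel N u * (1 / sqrt (real N) * (7 / d\<^sup>2 * (pi / d)))" for u
      unfolding norm_mult norm_of_real abs_of_nonneg[OF frac_kernel_nonneg] by (rule mult_left_mono[OF H frac_kernel_nonneg])
  qed
  also have "\<dots> = integral\<^sup>L lborel (frac_kernel N) * (1 / sqrt (real N) * (7 / d\<^sup>2 * (pi / d)))" by simp
  also have "\<dots> \<le> 2 / sqrt (real N) * (1 / sqrt (real N) * (7 / d\<^sup>2 * (pi / d)))"
    using integrable_frac_kernel(2)[OF N] d by (intro mult_right_mono) auto
  also have "\<dots> = 14 * pi / (d ^ 3 * real N)"
    using N d by (simp add: field_simps power2_eq_square power3_eq_cube)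
  finally show ?thesis .
qed

section \<open>Second moment of the Dirichlet polynomial\<close>

lemma dirichlet_sum_measurable [measurable]: "dirichlet_sum N \<in> borel_measurable borel"
  unfolding dirichlet_sum_def[abs_def] dirichlet_term_def by (intro borel_measurable_continuous_onI continuous_intros)

lemma norm_dirichlet_sum_le: "norm (dirichlet_sum N t) \<le> 2 * sqrt (real N)"
proof -
  have "norm (dirichlet_sum N t) \<le> (\<Sum>n=1..N. norm (dirichlet_term t n))"
    unfolding dirichlet_sum_def by (rule norm_sum)
  thus ?thesis using sum_inverse_sqrt_le[of N] by (simp add: norm_dirichlet_term)
qed

text \<open>Opening the square leaves the frequencies ln m - ln n, each integrated exactly by
  \<open>integral_power_exp_cis\<close> with k = 1.\<close>

lemma dirichlet_sum_second_moment:
  assumes d: "0 < d"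
  shows "complex_of_real (\<integral>t. power_exp 1 d t * (norm (dirichlet_sum N t))\<^sup>2 \<partial>lborel) =
    (\<Sum>m=1..N. \<Sum>n=1..N. of_real (1 / (sqrt (real m) * sqrt (real n))) * (1 / (Complex d (ln (real m) - ln (real n)))\<^sup>2))"
proof -
  define k where "k m n t = of_real (1 / (sqrt (real m) * sqrt (real n))) * (of_real (power_exp 1 d t) * cis (- ((ln (real m) - ln (real n)) * t)))"
    for m n t
  have i: "integrable lborel (k m n)" for m n
    unfolding k_def by (intro integrable_mult_right integrable_power_exp_mult d) auto
  have "complex_of_real (power_exp 1 d t * (norm (dirichlet_sum N t))\<^sup>2) = (\<Sum>m=1..N. \<Sum>n=1..N. k m n t)" for t
  proof -
    have "complex_of_real ((norm (dirichlet_sum N t))\<^sup>2) = dirichlet_sum N t * cnj (dirichlet_sum N t)"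
      by (rule complex_norm_square)
    also have "\<dots> = (\<Sum>m=1..N. \<Sum>n=1..N. dirichlet_term t m * (of_real (1 / sqrt (real n)) * cis (ln (real n) * t)))"
      unfolding cnj_dirichlet_sum by (simp add: dirichlet_sum_def sum_product)
    finally have "complex_of_real (power_exp 1 d t * (norm (dirichlet_sum N t))\<^sup>2) = (\<Sum>m=1..N. \<Sum>n=1..N. of_real (power_exp 1 d t) * (dirichlet_term t m * (of_real (1 / sqrt (real n)) * cis (ln (real n) * t))))"
      by (simp add: sum_distrib_left)
    also have "\<dots> = (\<Sum>m=1..N. \<Sum>n=1..N. k m n t)"
    proof (intro sum.cong refl)
      fix m n
      have "cis (- ((ln (real m) - ln (real n)) * t)) = cis (- (t * ln (real m))) * cis (ln (real n) * t)"
        by (simp add: cis_mult algebra_simps)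
      thus "of_real (power_exp 1 d t) * (dirichlet_term t m * (of_real (1 / sqrt (real n)) * cis (ln (real n) * t))) = k m n t"
        by (simp add: k_def dirichlet_term_def)
    qed
    finally show ?thesis .
  qed
  hence "complex_of_real (\<integral>t. power_exp 1 d t * (norm (dirichlet_sum N t))\<^sup>2 \<partial>lborel) = (\<integral>t. (\<Sum>m=1..N. \<Sum>n=1..N. k m n t) \<partial>lborel)"
    by (simp flip: integral_complex_of_real)
  also have "\<dots> = (\<Sum>m=1..N. \<Sum>n=1..N. integral\<^sup>L lborel (k m n))"
    using i by (simp add: Bochner_Integration.integral_sum)
  also have "\<dots> = (\<Sum>m=1..N. \<Sum>n=1..N. of_real (1 / (sqrt (real m) * sqrt (real n))) * (1 / (Complex d (ln (real m) - ln (real n)))\<^sup>2))"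
  proof (intro sum.cong refl)
    show "integral\<^sup>L lborel (k m n) = of_real (1 / (sqrt (real m) * sqrt (real n))) * (1 / (Complex d (ln (real m) - ln (real n)))\<^sup>2)" for m n
      unfolding k_def integral_mult_right_zero integral_power_exp_cis[OF d] by (simp add: power2_eq_square)
  qed
  finally show ?thesis .
qed

lemma abs_ln_diff_ge:
  fixes m n :: nat
  assumes "1 \<le> m" "m < n"
  shows "real (n - m) / real n \<le> \<bar>ln (real m) - ln (real n)\<bar>"
proof -
  have "ln (real m / real n) \<le> real m / real n - 1"
    using assms by (intro ln_le_minus_one) simp
  hence "1 - real m / real n \<le> ln (real n) - ln (real m)"
    using assms by (simp add: ln_div)
  thus ?thesis using assms by (simp add: of_nat_diff diff_divide_distrib)
qed

text \<open>Put r = n - m. The logarithms are at least r/n apart, which gives n^2 / r^2. Since n = m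
  + r is at most 4rm, sqrt (n/m) is at most 2 sqrt r. What remains depends on the distance through
  r^(-3/2), which is summable.\<close>

lemma off_diagonal_term_bound_aux:
  fixes m n :: nat
  assumes "1 \<le> m" "m < n"
  shows "1 / (sqrt (real m) * sqrt (real n)) * (1 / (ln (real m) - ln (real n))\<^sup>2)
      \<le> 2 * real n * (real (n - m) powr (-3/2))"
proof -
  define r where "r = real (n - m)"
  have r: "1 \<le> r" "r = real n - real m" using assms by (auto simp: r_def of_nat_diff)
  have n: "0 < real n" "0 < real m" using assms by auto
  have "(r / real n)\<^sup>2 \<le> (ln (real m) - ln (real n))\<^sup>2"
    using power_mono[OF abs_ln_diff_ge[OF assms], of 2] by (simp add: r_def)
  hence "1 / (ln (real m) - ln (real n))\<^sup>2 \<le> 1 / (r / real n)\<^sup>2"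
    using r n by (intro divide_left_mono mult_pos_pos) auto
  hence "1 / (sqrt (real m) * sqrt (real n)) * (1 / (ln (real m) - ln (real n))\<^sup>2)
      \<le> 1 / (sqrt (real m) * sqrt (real n)) * (1 / (r / real n)\<^sup>2)"
    using n by (intro mult_left_mono) auto
  also have "\<dots> = real n * (sqrt (real n / real m) / r\<^sup>2)"
  proof -
    define a b where "a = sqrt (real m)" and "b = sqrt (real n)"
    have "0 < a" "0 < b" using n by (auto simp: a_def b_def)
    hence "1 / (a * b) * (1 / (r / (b * b))\<^sup>2) = (b * b) * ((b / a) / r\<^sup>2)"
      using r by (simp add: divide_simps power2_eq_square)
    moreover have "b * b = real n" by (simp add: b_def)
    ultimately show ?thesis by (simp add: a_def b_def real_sqrt_divide)
  qed
  also have "\<dots> \<le> real n * (2 * (sqrt r / r\<^sup>2))"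
  proof -
    have "real n = real m + r" using r by simp
    moreover have "r \<le> r * real m" using assms r by (simp add: mult_le_cancel_left1)
    moreover have "real m \<le> r * real m" using n r by simp
    ultimately have "real n \<le> 4 * (r * real m)"
      using n r by linarith
    hence "real n / real m \<le> 4 * r"
      using n by (simp add: pos_divide_le_eq)
    hence "sqrt (real n / real m) \<le> sqrt (4 * r)" by simp
    also have "\<dots> = 2 * sqrt r" by (simp add: real_sqrt_mult)
    finally have "sqrt (real n / real m) / r\<^sup>2 \<le> 2 * sqrt r / r\<^sup>2"
      by (rule divide_right_mono) simp
    thus ?thesis using n by (intro mult_left_mono) auto
  qed
  also have "sqrt r / r\<^sup>2 = r powr (-3/2)"
  proof -
    have "sqrt r / r\<^sup>2 = r powr (1/2) / r powr 2" using r(1) by (simp add: powr_half_sqrt powr_numeral)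
    also have "\<dots> = r powr (1/2 - 2)" by (rule powr_diff[symmetric])
    finally show ?thesis by simp
  qed
  finally show ?thesis by (simp add: r_def mult_ac)
qed

lemma off_diagonal_term_bound:
  fixes m n :: nat
  assumes "m \<in> {1..N}" "n \<in> {1..N}" "m \<noteq> n"
  shows "norm (complex_of_real (1 / (sqrt (real m) * sqrt (real n))) * (1 / (Complex d (ln (real m) - ln (real n)))\<^sup>2))
      \<le> 2 * real N * (real (nat \<bar>int m - int n\<bar>) powr (-3/2))"
proof -
  define x where "x = ln (real m) - ln (real n)"
  have x: "x \<noteq> 0" using assms by (auto simp: x_def)
  have "x\<^sup>2 \<le> (norm (Complex d x))\<^sup>2" by (simp add: cmod_power2)
  hence "1 / (norm (Complex d x))\<^sup>2 \<le> 1 / x\<^sup>2"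
    using x by (intro divide_left_mono mult_pos_pos) (auto simp: complex_eq_iff)
  hence "norm (complex_of_real (1 / (sqrt (real m) * sqrt (real n))) * (1 / (Complex d x)\<^sup>2))
      \<le> 1 / (sqrt (real m) * sqrt (real n)) * (1 / x\<^sup>2)"
    unfolding norm_mult norm_of_real by (intro mult_mono) (auto simp: norm_divide norm_power)
  also have "\<dots> \<le> 2 * real N * (real (nat \<bar>int m - int n\<bar>) powr (-3/2))"
  proof (cases "m < n")
    case True
    have "1 / (sqrt (real m) * sqrt (real n)) * (1 / x\<^sup>2) \<le> 2 * real n * (real (n - m) powr (-3/2))"
      unfolding x_def using True assms by (intro off_diagonal_term_bound_aux) auto
    also have "\<dots> \<le> 2 * real N * (real (n - m) powr (-3/2))"
      using assms by (intro mult_right_mono) auto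
    also have "n - m = nat \<bar>int m - int n\<bar>" using True by auto
    finally show ?thesis .
  next
    case False
    have "1 / (sqrt (real n) * sqrt (real m)) * (1 / (ln (real n) - ln (real m))\<^sup>2) \<le> 2 * real m * (real (m - n) powr (-3/2))"
      using False assms by (intro off_diagonal_term_bound_aux) auto
    also have "\<dots> \<le> 2 * real N * (real (m - n) powr (-3/2))"
      using assms by (intro mult_right_mono) auto
    also have "m - n = nat \<bar>int m - int n\<bar>" using False by auto
    finally show ?thesis by (simp add: x_def power2_commute mult.commute)
  qed
  finally show ?thesis by (simp add: x_def)
qed

text \<open>The index 0 contributes nothing because \<open>0 powr x = 0\<close>.\<close>

definition zeta_three_halves :: real where "zeta_three_halves = (\<Sum>r. real r powr (-3/2))"

lemma sum_powr_le_zeta_three_halves: "finite A \<Longrightarrow> (\<Sum>r\<in>A. real r powr (-3/2)) \<le> zeta_three_halves"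
  unfolding zeta_three_halves_def by (intro sum_le_suminf) (auto simp: summable_real_powr_iff)

text \<open>Each distance occurs at most once on either side of \<open>m\<close>, hence the factor
  2.\<close>

lemma sum_distance_powr_le:
  assumes "m \<in> {1..N}"
  shows "(\<Sum>n\<in>{1..N}-{m}. real (nat \<bar>int m - int n\<bar>) powr (-3/2)) \<le> 2 * zeta_three_halves"
proof -
  define f where "f n = real (nat \<bar>int m - int n\<bar>) powr (-3/2)" for n :: nat
  have "{1..N} - {m} = {1..<m} \<union> {m<..N}" using assms by auto
  moreover have "{1..<m} \<inter> {m<..N} = {}" by auto
  ultimately have "(\<Sum>n\<in>{1..N}-{m}. f n) = (\<Sum>n\<in>{1..<m}. f n) + (\<Sum>n\<in>{m<..N}. f n)"
    by (simp add: sum.union_disjoint)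
  also have "(\<Sum>n\<in>{1..<m}. f n) = (\<Sum>r\<in>(\<lambda>n. m - n) ` {1..<m}. real r powr (-3/2))"
    by (subst sum.reindex) (auto simp: inj_on_def f_def o_def intro!: sum.cong arg_cong[where f = "\<lambda>x. x powr _"])
  also have "(\<Sum>n\<in>{m<..N}. f n) = (\<Sum>r\<in>(\<lambda>n. n - m) ` {m<..N}. real r powr (-3/2))"
    by (subst sum.reindex) (auto simp: inj_on_def f_def o_def intro!: sum.cong arg_cong[where f = "\<lambda>x. x powr _"])
  also have "(\<Sum>r\<in>(\<lambda>n. m - n) ` {1..<m}. real r powr (-3/2)) + (\<Sum>r\<in>(\<lambda>n. n - m) ` {m<..N}. real r powr (-3/2)) \<le> zeta_three_halves + zeta_three_halves"
    by (intro add_mono sum_powr_le_zeta_three_halves) auto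
  finally show ?thesis by (simp add: f_def)
qed

text \<open>The diagonal terms 1 / (m d^2) add up to the harmonic number. Off the diagonal there are
  N rows, each at most 2N times 2 zeta(3/2).\<close>

lemma dirichlet_sum_second_moment_bound:
  assumes d: "0 < d"
  shows "\<bar>(\<integral>t. power_exp 1 d t * (norm (dirichlet_sum N t))\<^sup>2 \<partial>lborel) - harm N / d\<^sup>2\<bar> \<le> 4 * zeta_three_halves * (real N)\<^sup>2"
proof -
  define c where "c m n = complex_of_real (1 / (sqrt (real m) * sqrt (real n))) * (1 / (Complex d (ln (real m) - ln (real n)))\<^sup>2)" for m n
  have "complex_of_real (\<integral>t. power_exp 1 d t * (norm (dirichlet_sum N t))\<^sup>2 \<partial>lborel) = (\<Sum>m=1..N. \<Sum>n=1..N. c m n)"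
    unfolding c_def by (rule dirichlet_sum_second_moment[OF d])
  also have "\<dots> = (\<Sum>m=1..N. c m m + (\<Sum>n\<in>{1..N}-{m}. c m n))"
    by (intro sum.cong refl sum.remove) auto
  also have "\<dots> = (\<Sum>m=1..N. c m m) + (\<Sum>m=1..N. \<Sum>n\<in>{1..N}-{m}. c m n)"
    by (rule sum.distrib)
  also have "(\<Sum>m=1..N. c m m) = complex_of_real (harm N / d\<^sup>2)"
  proof -
    have "c m m = complex_of_real (inverse (real m) / d\<^sup>2)" for m
      by (simp add: c_def inverse_eq_divide flip: complex_of_real_def)
    thus ?thesis by (simp add: harm_def sum_divide_distrib)
  qed
  finally have "complex_of_real ((\<integral>t. power_exp 1 d t * (norm (dirichlet_sum N t))\<^sup>2 \<partial>lborel) - harm N / d\<^sup>2) = (\<Sum>m=1..N. \<Sum>n\<in>{1..N}-{m}. c m n)"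
    by simp
  from arg_cong[OF this, of norm]
  have "\<bar>(\<integral>t. power_exp 1 d t * (norm (dirichlet_sum N t))\<^sup>2 \<partial>lborel) - harm N / d\<^sup>2\<bar> = norm (\<Sum>m=1..N. \<Sum>n\<in>{1..N}-{m}. c m n)"
    by (simp only: norm_of_real)
  also have "\<dots> \<le> (\<Sum>m=1..N. 4 * zeta_three_halves * real N)"
  proof (rule sum_norm_le)
    fix m assume m: "m \<in> {1..N}"
    have "norm (\<Sum>n\<in>{1..N}-{m}. c m n) \<le> (\<Sum>n\<in>{1..N}-{m}. 2 * real N * (real (nat \<bar>int m - int n\<bar>) powr (-3/2)))"
      unfolding c_def using m by (intro sum_norm_le off_diagonal_term_bound) auto
    also have "\<dots> = 2 * real N * (\<Sum>n\<in>{1..N}-{m}. real (nat \<bar>int m - int n\<bar>) powr (-3/2))"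
      by (rule sum_distrib_left[symmetric])
    also have "\<dots> \<le> 2 * real N * (2 * zeta_three_halves)"
      using sum_distance_powr_le[OF m] by (intro mult_left_mono) auto
    finally show "norm (\<Sum>n\<in>{1..N}-{m}. c m n) \<le> 4 * zeta_three_halves * real N" by (simp add: mult_ac)
  qed
  also have "\<dots> = 4 * zeta_three_halves * (real N)\<^sup>2" by (simp add: power2_eq_square)
  finally show ?thesis .
qed

section \<open>Continuity and polynomial growth of Z^2\<close>

lemma norm_one_minus_Complex_half: "norm (1 - Complex (1/2) t) ^ 2 = 1/4 + t\<^sup>2"
  by (simp add: cmod_power2 power_divide)

lemma norm_polar_term:
  assumes "1 \<le> N"
  shows "norm (polar_term N t) = sqrt (real N) / norm (1 - Complex (1/2) t)"
proof -
  have "real N / sqrt (real N) = sqrt (real N)" by (rule real_div_sqrt) simp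
  thus ?thesis by (simp add: polar_term_def norm_mult norm_divide norm_dirichlet_term)
qed

lemma continuous_on_Complex: "continuous_on S (\<lambda>t. Complex a t)"
  by (simp add: Complex_eq) (intro continuous_intros)

text \<open>The defining series converges only conditionally, so continuity is read off from the
  formula with N = 1, whose remainder is the Fourier transform of an integrable function.\<close>

lemma continuous_on_Z2: "continuous_on UNIV Z2"
proof -
  have nz: "1 - Complex (1/2) t \<noteq> 0" for t by (simp add: complex_eq_iff)
  have gh: "continuous_on UNIV (frac_transform 1)"
    unfolding frac_transform_def using integrable_frac_kernel(1)[of 1] by (intro continuous_on_fourier) simp
  have "Z2 = (\<lambda>t. (cmod (dirichlet_sum 1 t - polar_term 1 t - Complex (1/2) t * frac_transform 1 t))\<^sup>2)"
    unfolding Z2_def[abs_def] zeta_crit_eq_approx[OF order.refl] ..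
  moreover have "continuous_on UNIV (\<lambda>t. (cmod (dirichlet_sum 1 t - polar_term 1 t - Complex (1/2) t * frac_transform 1 t))\<^sup>2)"
    unfolding dirichlet_sum_def polar_term_def dirichlet_term_def using nz by (intro continuous_intros continuous_on_Complex gh) auto
  ultimately show ?thesis by (simp only:)
qed

lemma Z2_measurable [measurable]: "Z2 \<in> borel_measurable borel"
  by (rule borel_measurable_continuous_onI[OF continuous_on_Z2])

lemma Z2_nonneg: "0 \<le> Z2 t" by (simp add: Z2_def)

text \<open>A crude bound from the formula with N = 1. It serves for integrability against
  exponentials and for the range where the exponential is already tiny.\<close>

lemma Z2_le: "Z2 t \<le> 32 + 8 * t\<^sup>2"
proof -
  define s where "s = Complex (1/2) t"
  have "norm (1 - s) ^ 2 \<ge> (1/2)\<^sup>2" unfolding s_def norm_one_minus_Complex_half by (simp add: power_divide)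
  hence s1: "norm (1 - s) \<ge> 1/2" by (rule power2_le_imp_le) simp
  have s2: "norm s \<le> 1/2 + \<bar>t\<bar>" using cmod_le[of s] by (simp add: s_def)
  have "norm (zeta_crit t) \<le> norm (dirichlet_sum 1 t) + norm (polar_term 1 t) + norm s * norm (frac_transform 1 t)"
    unfolding zeta_crit_eq_approx[OF order.refl] s_def[symmetric] norm_mult[symmetric]
    using norm_triangle_ineq4[of "dirichlet_sum 1 t - polar_term 1 t" "s * frac_transform 1 t"] norm_triangle_ineq4[of "dirichlet_sum 1 t" "polar_term 1 t"] by linarith
  also have "\<dots> \<le> 1 + 2 + (1/2 + \<bar>t\<bar>) * 2"
  proof (intro add_mono mult_mono)
    show "norm (dirichlet_sum 1 t) \<le> 1" by (simp add: dirichlet_sum_def norm_dirichlet_term)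
    show "norm (polar_term 1 t) \<le> 2" using s1 by (simp add: norm_polar_term s_def[symmetric] divide_le_eq)
    show "norm (frac_transform 1 t) \<le> 2" using norm_frac_transform_le[of 1 t] by simp
  qed (use s2 in auto)
  finally have "norm (zeta_crit t) \<le> 4 + 2 * \<bar>t\<bar>" by simp
  hence "Z2 t \<le> (4 + 2 * \<bar>t\<bar>)\<^sup>2" unfolding Z2_def by (intro power_mono) auto
  also have "\<dots> \<le> 32 + 8 * t\<^sup>2"
  proof -
    have "0 \<le> (4 - 2 * \<bar>t\<bar>)\<^sup>2" by simp
    thus ?thesis by (simp add: power2_eq_square algebra_simps)
  qed
  finally show ?thesis .
qed

lemma integrable_power_exp_Z2:
  assumes "0 < d" shows "integrable lborel (\<lambda>t. power_exp k d t * Z2 t)"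
proof (rule Bochner_Integration.integrable_bound)
  show "integrable lborel (\<lambda>t. 32 * power_exp k d t + 8 * power_exp (Suc (Suc k)) d t)"
    using integrable_power_exp[OF assms] by simp
  have "power_exp k d t * Z2 t \<le> 32 * power_exp k d t + 8 * power_exp (Suc (Suc k)) d t" for t
    using mult_left_mono[OF Z2_le power_exp_nonneg[of k d t], of t]
    by (simp add: algebra_simps power2_eq_square flip: power_exp_mult)
  thus "AE t in lborel. norm (power_exp k d t * Z2 t) \<le> norm (32 * power_exp k d t + 8 * power_exp (Suc (Suc k)) d t)"
    by (intro AE_I2) (auto simp: Z2_nonneg power_exp_nonneg intro: order.trans[OF _ abs_ge_self])
qed simp

text \<open>Write zeta = S - (P + X) with Dirichlet sum S, polar term P and remainder X. The square
  of S gives the harmonic number, the product of S and X is handled by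
  \<open>cross_term_bound\<close>, the square of X by \<open>error_term_bound\<close>, and
  everything involving P is estimated pointwise.\<close>

lemma moment_harm_bound:
  assumes d: "0 < d" "d \<le> 1" and N: "1 \<le> N"
  shows "\<bar>(\<integral>t. power_exp 1 d t * Z2 t \<partial>lborel) - harm N / d\<^sup>2\<bar>
     \<le> 4 * zeta_three_halves * (real N)\<^sup>2 + 12 * pi / d\<^sup>2 + 6 * real N / d + 28 * pi / (d ^ 3 * real N)"
proof -
  note [measurable] = frac_transform_measurable[OF N]
  define w where "w = power_exp 1 d"
  define A where "A t = w t * (norm (dirichlet_sum N t))\<^sup>2" for t
  define B where "B t = of_real (w t) * cnj (dirichlet_sum N t) * (Complex (1/2) t * frac_transform N t)" for t
  define D where "D t = w t * (norm (Complex (1/2) t))\<^sup>2 * (norm (frac_transform N t))\<^sup>2" for t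
  have m [measurable]: "(\<lambda>t. Complex (1/2) t) \<in> borel_measurable borel"
    by (intro borel_measurable_continuous_onI continuous_on_Complex)
  have mc [measurable]: "(\<lambda>t. cnj (dirichlet_sum N t)) \<in> borel_measurable borel"
    by (rule measurable_compose[OF dirichlet_sum_measurable]) (intro borel_measurable_continuous_onI continuous_intros)
  have w0: "0 \<le> w t" for t by (simp add: w_def power_exp_nonneg)
  have [measurable]: "w \<in> borel_measurable borel" by (simp add: w_def)
  have w: "integrable lborel w" using integrable_power_exp[OF d(1)] by (simp add: w_def)
  have g2: "norm (frac_transform N t) \<le> 2" for t
  proof -
    have "2 / sqrt (real N) \<le> 2" using N by (simp add: divide_le_eq)
    thus ?thesis using norm_frac_transform_le[OF N, of t] by linarith
  qed
  have iA: "integrable lborel A"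
  proof (rule Bochner_Integration.integrable_bound)
    show "integrable lborel (\<lambda>t. w t * (2 * sqrt (real N))\<^sup>2)" using w by simp
    have "(norm (dirichlet_sum N t))\<^sup>2 \<le> (2 * sqrt (real N))\<^sup>2" for t
      using norm_dirichlet_sum_le by (intro power_mono) auto
    from mult_left_mono[OF this w0]
    show "AE t in lborel. norm (A t) \<le> norm (w t * (2 * sqrt (real N))\<^sup>2)"
      by (intro AE_I2) (simp add: A_def w0)
  qed (unfold A_def, measurable)
  have iW1: "integrable lborel (\<lambda>t. norm (weight_s d t))" using integrable_weight_s[OF d(1)] by simp
  have iW2: "integrable lborel (\<lambda>t. norm (weight_s2 d t))" using integrable_weight_s2[OF d(1)] by simp
  have iB: "integrable lborel B"
  proof (rule Bochner_Integration.integrable_bound)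
    show "integrable lborel (\<lambda>t. norm (weight_s d t) * (2 * sqrt (real N) * 2))" using iW1 by simp
    have "norm (B t) = norm (weight_s d t) * (norm (dirichlet_sum N t) * norm (frac_transform N t))" for t
      by (simp add: B_def weight_s_def w_def norm_mult)
    moreover have "norm (dirichlet_sum N t) * norm (frac_transform N t) \<le> 2 * sqrt (real N) * 2" for t
      using norm_dirichlet_sum_le g2 by (intro mult_mono) auto
    ultimately show "AE t in lborel. norm (B t) \<le> norm (norm (weight_s d t) * (2 * sqrt (real N) * 2))"
      by (intro AE_I2) (simp add: mult_left_mono)
  qed (unfold B_def, measurable)
  have D_weight_s2: "complex_of_real (D t) = weight_s2 d t * (cnj (frac_transform N t) * frac_transform N t)" for t
    unfolding D_def weight_s2_def w_def of_real_mult complex_norm_square by (simp add: mult_ac)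
  have iD: "integrable lborel D"
  proof (rule Bochner_Integration.integrable_bound)
    show "integrable lborel (\<lambda>t. norm (weight_s2 d t) * 2\<^sup>2)" using iW2 by simp
    have "norm (D t) = norm (weight_s2 d t) * (norm (frac_transform N t))\<^sup>2" for t
      by (simp add: D_def weight_s2_def w_def abs_mult norm_mult norm_power)
    moreover have "(norm (frac_transform N t))\<^sup>2 \<le> 2\<^sup>2" for t using g2 by (intro power_mono) auto
    ultimately show "AE t in lborel. norm (D t) \<le> norm (norm (weight_s2 d t) * 2\<^sup>2)"
      by (intro AE_I2) (simp add: mult_left_mono)
  qed (unfold D_def, measurable)
  have iZ: "integrable lborel (\<lambda>t. w t * Z2 t)" using integrable_power_exp_Z2[OF d(1)] by (simp add: w_def)
  have iE: "integrable lborel (power_exp 0 d)" by (rule integrable_power_exp[OF d(1)])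
  \<comment> \<open>\<open>A\<close> and \<open>B\<close> are split off because they are integrated
    with their oscillation. In the rest, the mixed term of P and X is removed by |P + X|^2 <= 2|P|^2
    + 2|X|^2. The coefficient 6 is 2 * 2 from |S||P| plus 2 from |P|^2.\<close>
  have pt: "\<bar>w t * Z2 t - A t + 2 * Re (B t)\<bar> \<le> 6 * real N * power_exp 0 d t + 2 * D t" for t
  proof -
    define s where "s = Complex (1/2) t"
    define S where "S = dirichlet_sum N t"
    define P where "P = polar_term N t"
    define X where "X = s * frac_transform N t"
    have z: "zeta_crit t = S - (P + X)"
      using zeta_crit_eq_approx[OF N, of t] by (simp add: S_def P_def X_def s_def)
    have "Z2 t = (norm S)\<^sup>2 - 2 * Re (cnj S * (P + X)) + (norm (P + X))\<^sup>2"
      unfolding Z2_def z by (simp only: cmod_power2) (simp add: power2_eq_square algebra_simps)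
    hence "Z2 t - (norm S)\<^sup>2 + 2 * Re (cnj S * X) = - 2 * Re (cnj S * P) + (norm (P + X))\<^sup>2"
      by (simp add: algebra_simps)
    also have "\<bar>\<dots>\<bar> \<le> 2 * (norm S * norm P) + (2 * (norm P)\<^sup>2 + 2 * (norm X)\<^sup>2)"
    proof -
      have "\<bar>Re (cnj S * P)\<bar> \<le> norm S * norm P"
        using abs_Re_le_cmod[of "cnj S * P"] by (simp add: norm_mult)
      moreover have "(norm (P + X))\<^sup>2 \<le> 2 * (norm P)\<^sup>2 + 2 * (norm X)\<^sup>2"
      proof -
        have "(norm (P + X))\<^sup>2 \<le> (norm P + norm X)\<^sup>2"
          by (intro power_mono norm_triangle_ineq) auto
        moreover have "0 \<le> (norm P - norm X)\<^sup>2" by simp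
        ultimately show ?thesis by (simp add: power2_eq_square algebra_simps)
      qed
      moreover have "0 \<le> (norm (P + X))\<^sup>2" by simp
      ultimately show ?thesis by linarith
    qed
    finally have le: "w t * \<bar>Z2 t - (norm S)\<^sup>2 + 2 * Re (cnj S * X)\<bar> \<le> w t * (2 * (norm S * norm P) + (2 * (norm P)\<^sup>2 + 2 * (norm X)\<^sup>2))"
      by (rule mult_left_mono[OF _ w0])
    have "w t * (Z2 t - (norm S)\<^sup>2 + 2 * Re (cnj S * X)) = w t * Z2 t - A t + 2 * Re (B t)"
      by (simp add: A_def B_def S_def X_def s_def algebra_simps)
    hence "\<bar>w t * Z2 t - A t + 2 * Re (B t)\<bar> = w t * \<bar>Z2 t - (norm S)\<^sup>2 + 2 * Re (cnj S * X)\<bar>"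
      by (metis abs_mult abs_of_nonneg w0)
    moreover have "w t * (2 * (norm S * norm P) + (2 * (norm P)\<^sup>2 + 2 * (norm X)\<^sup>2))
        = 2 * (w t * (norm S * norm P)) + 2 * (w t * (norm P)\<^sup>2) + 2 * D t"
      by (simp add: D_def X_def s_def norm_mult power_mult_distrib algebra_simps)
    ultimately have 1: "\<bar>w t * Z2 t - A t + 2 * Re (B t)\<bar> \<le> 2 * (w t * (norm S * norm P)) + 2 * (w t * (norm P)\<^sup>2) + 2 * D t"
      using le by linarith
    define q where "q = norm (1 - s)"
    have q2: "q\<^sup>2 = 1/4 + t\<^sup>2" unfolding q_def s_def by (rule norm_one_minus_Complex_half)
    have q: "0 < q" using q2 by (auto simp: q_def s_def complex_eq_iff)
    have nP: "norm P = sqrt (real N) / q" unfolding P_def q_def s_def by (rule norm_polar_term[OF N])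
    have wt: "w t = t * power_exp 0 d t" by (simp add: w_def power_exp_def)
    have e: "0 \<le> power_exp 0 d t" by (rule power_exp_nonneg)
    \<comment> \<open>The modulus of P is sqrt N / |1 - s|, and t <= |1 - s| cancels the factor
      \<open>t\<close> of the weight.\<close>
    have "w t * (norm S * norm P) \<le> 2 * real N * power_exp 0 d t"
    proof -
      have "w t * (norm S * norm P) \<le> w t * (2 * sqrt (real N) * norm P)"
        unfolding S_def using w0 norm_dirichlet_sum_le by (intro mult_left_mono mult_right_mono) auto
      also have "\<dots> = (t / q) * (2 * real N * power_exp 0 d t)"
        by (simp add: nP wt)
      also have "\<dots> \<le> 1 * (2 * real N * power_exp 0 d t)"
      proof (intro mult_right_mono)
        have "t\<^sup>2 \<le> q\<^sup>2" using q2 by simp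
        hence "t \<le> q" by (rule power2_le_imp_le) (use q in simp)
        thus "t / q \<le> 1" using q by simp
      qed (use e in auto)
      finally show ?thesis by simp
    qed
    moreover have "w t * (norm P)\<^sup>2 \<le> real N * power_exp 0 d t"
    proof -
      have "w t * (norm P)\<^sup>2 = (t / q\<^sup>2) * (real N * power_exp 0 d t)"
        by (simp add: nP wt power_divide)
      also have "\<dots> \<le> 1 * (real N * power_exp 0 d t)"
      proof (intro mult_right_mono)
        have "0 \<le> (t - 1/2)\<^sup>2" by simp
        hence "t \<le> q\<^sup>2" unfolding q2 by (simp add: power2_eq_square algebra_simps)
        thus "t / q\<^sup>2 \<le> 1" using q by simp
      qed (use e in auto)
      finally show ?thesis by simp
    qed
    ultimately show ?thesis using 1 by linarith
  qed
  have "(\<integral>t. w t * Z2 t - A t + 2 * Re (B t) \<partial>lborel) = (\<integral>t. w t * Z2 t \<partial>lborel) - integral\<^sup>L lborel A + 2 * Re (integral\<^sup>L lborel B)"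
    using iA iB iZ by simp
  moreover have "\<bar>\<integral>t. w t * Z2 t - A t + 2 * Re (B t) \<partial>lborel\<bar> \<le> (\<integral>t. 6 * real N * power_exp 0 d t + 2 * D t \<partial>lborel)"
    using norm_integral_le[of "\<lambda>t. 6 * real N * power_exp 0 d t + 2 * D t" "\<lambda>t. w t * Z2 t - A t + 2 * Re (B t)"] pt iE iD by simp
  moreover have "(\<integral>t. 6 * real N * power_exp 0 d t + 2 * D t \<partial>lborel) = 6 * real N / d + 2 * integral\<^sup>L lborel D"
    using iE iD integral_power_exp[OF d(1), of 0] by simp
  moreover have "\<bar>Re (integral\<^sup>L lborel B)\<bar> \<le> 6 * pi / d\<^sup>2"
    by (rule order.trans[OF abs_Re_le_cmod]) (use cross_term_bound[OF d N] in \<open>simp add: B_def[abs_def] w_def\<close>)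
  moreover have "integral\<^sup>L lborel D \<le> 14 * pi / (d ^ 3 * real N)"
  proof -
    have "complex_of_real (integral\<^sup>L lborel D) = (\<integral>t. weight_s2 d t * (cnj (frac_transform N t) * frac_transform N t) \<partial>lborel)"
      by (simp add: D_weight_s2 flip: integral_complex_of_real)
    hence "norm (complex_of_real (integral\<^sup>L lborel D)) \<le> 14 * pi / (d ^ 3 * real N)"
      using error_term_bound[OF d N] by (simp only:)
    hence "\<bar>integral\<^sup>L lborel D\<bar> \<le> 14 * pi / (d ^ 3 * real N)"
      by (simp only: norm_of_real)
    thus ?thesis by linarith
  qed
  moreover have "\<bar>integral\<^sup>L lborel A - harm N / d\<^sup>2\<bar> \<le> 4 * zeta_three_halves * (real N)\<^sup>2"
    using dirichlet_sum_second_moment_bound[OF d(1)] by (simp add: A_def[abs_def] w_def)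
  ultimately show ?thesis unfolding w_def by linarith
qed

section \<open>The moment L(d) and its behaviour as d tends to 0\<close>

definition moment :: "real \<Rightarrow> real" where "moment d = (\<integral>t. power_exp 1 d t * Z2 t \<partial>lborel)"

text \<open>Taking N of size 1/d balances the errors N^2, N/d and 1 / (d^3 N): all become O(d^-2).
  With this choice the harmonic number is ln (1/d) + O(1).\<close>

lemma moment_asymptotics: "\<exists>C. \<forall>d. 0 < d \<and> d \<le> 1 \<longrightarrow> \<bar>moment d - ln (1 / d) / d\<^sup>2\<bar> \<le> C / d\<^sup>2"
proof (intro exI allI impI)
  fix d :: real assume d: "0 < d \<and> d \<le> 1"
  define N where "N = nat \<lceil>1 / d\<rceil>"
  have d1: "1 \<le> 1 / d" using d by simp
  have N: "1 / d \<le> real N" "real N \<le> 1 / d + 1" unfolding N_def using d1 by linarith+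
  have N1: "1 \<le> N" using N(1) d1 by linarith
  have N2: "real N \<le> 2 / d" using N d1 by simp
  have Z: "0 \<le> zeta_three_halves" using sum_powr_le_zeta_three_halves[of "{}"] by simp
  have sq: "1 / d\<^sup>2 > 0" using d by simp
  have "\<bar>moment d - harm N / d\<^sup>2\<bar> \<le> 4 * zeta_three_halves * (real N)\<^sup>2 + 12 * pi / d\<^sup>2 + 6 * real N / d + 28 * pi / (d ^ 3 * real N)"
    unfolding moment_def using d N1 by (intro moment_harm_bound) auto
  also have "\<dots> \<le> 4 * zeta_three_halves * (2 / d)\<^sup>2 + 12 * pi / d\<^sup>2 + 6 * (2 / d) / d + 28 * pi / (d ^ 3 * (1 / d))"
    using d N N2 N1 Z by (intro add_mono mult_left_mono power_mono divide_right_mono divide_left_mono mult_pos_pos) auto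
  also have "\<dots> = (16 * zeta_three_halves + 40 * pi + 12) / d\<^sup>2"
    using d by (simp add: field_simps power2_eq_square power3_eq_cube)
  finally have 1: "\<bar>moment d - harm N / d\<^sup>2\<bar> \<le> (16 * zeta_three_halves + 40 * pi + 12) / d\<^sup>2" .
  have "ln (1 / d) \<le> ln (real N + 1)" using N d by (intro ln_mono) auto
  also have "\<dots> \<le> harm N" by (rule ln_le_harm)
  finally have h1: "ln (1 / d) \<le> harm N" .
  have "harm N - ln (real N) \<le> 1"
    using decseqD[OF decseq_harm_diff_ln, of 0 "N - 1"] N1 by (simp add: harm_expand)
  moreover have "ln (real N) \<le> ln (2 / d)" using N1 N2 d by (intro ln_mono) auto
  moreover have "ln (2 / d) = ln 2 + ln (1 / d)" using d by (simp add: ln_div)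
  moreover have "ln (2::real) \<le> 1" using ln_le_minus_one[of 2] by simp
  ultimately have h2: "harm N \<le> ln (1 / d) + 2" by linarith
  have "\<bar>(harm N - ln (1 / d)) * (1 / d\<^sup>2)\<bar> \<le> 2 * (1 / d\<^sup>2)"
    unfolding abs_mult using h1 h2 sq by (intro mult_mono) auto
  hence "\<bar>harm N / d\<^sup>2 - ln (1 / d) / d\<^sup>2\<bar> \<le> 2 / d\<^sup>2" by (simp add: left_diff_distrib diff_divide_distrib)
  with 1 show "\<bar>moment d - ln (1 / d) / d\<^sup>2\<bar> \<le> (16 * zeta_three_halves + 40 * pi + 14) / d\<^sup>2"
    by (simp add: add_divide_distrib)
qed

section \<open>Increments of the ladder integral\<close>

text \<open>This is F(y) of the opening comment.\<close>

definition ladder_integral :: "real \<Rightarrow> real" where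
  "ladder_integral y = integral {0..mu y} (\<lambda>t. Z2 t * exp (- (2 / y) * t))"

definition truncated_moment :: "real \<Rightarrow> real \<Rightarrow> real" where
  "truncated_moment d X = integral {0..X} (\<lambda>t. t * exp (- d * t) * Z2 t)"

lemma continuous_Z2 [continuous_intros]: "continuous_on S Z2"
  using continuous_on_subset[OF continuous_on_Z2] by blast

text \<open>For t > X half of the decay is spent on the small factor e^(-dX/2), and the other half
  keeps the integral convergent, giving the moment at d/2.\<close>

lemma truncated_moment_bounds:
  assumes d: "0 < d" and X: "0 \<le> X"
  shows "truncated_moment d X \<le> moment d" "moment d - truncated_moment d X \<le> exp (- d * X / 2) * moment (d / 2)"
proof -
  define f where "f t = t * exp (- d * t) * Z2 t" for t
  have cf: "continuous_on {0..X} f" unfolding f_def by (intro continuous_intros)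
  have si: "set_integrable lborel {0..X} f" by (rule borel_integrable_atLeastAtMost'[OF cf])
  have "(LINT t:{0..X}|lborel. f t) = integral {0..X} f"
    by (rule set_borel_integral_eq_integral(2)[OF si])
  hence tf: "truncated_moment d X = (\<integral>t. indicator {0..X} t * f t \<partial>lborel)"
    by (simp add: truncated_moment_def f_def[abs_def] set_lebesgue_integral_def)
  have i1: "integrable lborel (\<lambda>t. indicator {0..X} t * f t)"
    using si by (simp add: set_integrable_def)
  have i2: "integrable lborel (\<lambda>t. power_exp 1 d t * Z2 t)" by (rule integrable_power_exp_Z2[OF d])
  have i3: "integrable lborel (\<lambda>t. exp (- d * X / 2) * (power_exp 1 (d / 2) t * Z2 t))"
    using integrable_power_exp_Z2[of "d / 2" 1] d by simp
  have le: "indicator {0..X} t * f t \<le> power_exp 1 d t * Z2 t" for t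
    by (auto simp: indicator_def f_def power_exp_def Z2_nonneg)
  have le2: "power_exp 1 d t * Z2 t - indicator {0..X} t * f t \<le> exp (- d * X / 2) * (power_exp 1 (d / 2) t * Z2 t)" for t
  proof (cases "X < t")
    case True
    have "d * X \<le> d * t" using True d by simp
    hence "exp (- (d * t)) \<le> exp (- d * X / 2 + - (d / 2 * t))" by (subst exp_le_cancel_iff) (simp add: field_simps)
    hence "exp (- (d * t)) \<le> exp (- d * X / 2) * exp (- (d / 2 * t))" by (simp only: exp_add)
    hence "exp (- (d * t)) * (t * Z2 t) \<le> exp (- d * X / 2) * exp (- (d / 2 * t)) * (t * Z2 t)"
      using True X by (intro mult_right_mono) (auto simp: Z2_nonneg)
    thus ?thesis using True X by (simp add: power_exp_def indicator_def mult_ac)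
  next
    case False
    hence "power_exp 1 d t * Z2 t - indicator {0..X} t * f t = 0"
      by (auto simp: indicator_def f_def power_exp_def)
    moreover have "0 \<le> exp (- d * X / 2) * (power_exp 1 (d / 2) t * Z2 t)"
      by (intro mult_nonneg_nonneg) (auto simp: power_exp_nonneg Z2_nonneg)
    ultimately show ?thesis by linarith
  qed
  show "truncated_moment d X \<le> moment d"
    unfolding tf moment_def by (rule integral_mono[OF i1 i2 le])
  have "moment d - truncated_moment d X = (\<integral>t. power_exp 1 d t * Z2 t - indicator {0..X} t * f t \<partial>lborel)"
    unfolding tf moment_def by (rule Bochner_Integration.integral_diff[OF i2 i1, symmetric])
  also have "\<dots> \<le> (\<integral>t. exp (- d * X / 2) * (power_exp 1 (d / 2) t * Z2 t) \<partial>lborel)"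
    by (rule integral_mono[OF Bochner_Integration.integrable_diff[OF i2 i1] i3 le2])
  also have "\<dots> = exp (- d * X / 2) * moment (d / 2)" unfolding moment_def by (rule integral_mult_right_zero)
  finally show "moment d - truncated_moment d X \<le> exp (- d * X / 2) * moment (d / 2)" .
qed

text \<open>As a function of c, exp(-ct) is convex and so lies above its tangents at c = a and at c
  = b.\<close>

lemma exp_diff_bounds:
  fixes a b t :: real
  shows "(a - b) * (t * exp (- a * t)) \<le> exp (- b * t) - exp (- a * t)"
    and "exp (- b * t) - exp (- a * t) \<le> (a - b) * (t * exp (- b * t))"
proof -
  have "exp (- a * t) * (1 + (a - b) * t) \<le> exp (- a * t) * exp ((a - b) * t)"
    by (intro mult_left_mono exp_ge_add_one_self) auto
  also have "\<dots> = exp (- b * t)" by (simp add: exp_add[symmetric] algebra_simps)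
  finally show "(a - b) * (t * exp (- a * t)) \<le> exp (- b * t) - exp (- a * t)" by (simp add: algebra_simps)
  have "exp (- b * t) * (1 + (b - a) * t) \<le> exp (- b * t) * exp ((b - a) * t)"
    by (intro mult_left_mono exp_ge_add_one_self) auto
  also have "\<dots> = exp (- a * t)" by (simp add: exp_add[symmetric] algebra_simps)
  finally show "exp (- b * t) - exp (- a * t) \<le> (a - b) * (t * exp (- b * t))" by (simp add: algebra_simps)
qed

lemma mu_diff_le:
  assumes "1 \<le> y1" "y1 \<le> y2"
  shows "0 \<le> mu y1" "mu y1 \<le> mu y2" "mu y2 - mu y1 \<le> 7 * (y2 - y1) * (ln y2 + 1)"
proof -
  show "0 \<le> mu y1" using assms by (simp add: mu_def)
  show "mu y1 \<le> mu y2" unfolding mu_def using assms by (intro mult_mono) auto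
  have "ln (y2 / y1) \<le> y2 / y1 - 1" using assms by (intro ln_le_minus_one) auto
  hence "y1 * (ln y2 - ln y1) \<le> y1 * (y2 / y1 - 1)"
    using assms by (intro mult_left_mono) (auto simp: ln_div)
  hence "y1 * (ln y2 - ln y1) \<le> y2 - y1" using assms by (simp add: right_diff_distrib)
  thus "mu y2 - mu y1 \<le> 7 * (y2 - y1) * (ln y2 + 1)" by (simp add: mu_def algebra_simps)
qed

text \<open>Passing from y1 to y2 changes the exponent on the old range (\<open>J\<close>) and adds
  a new range (\<open>K\<close>). The tangent bounds control \<open>J\<close>, and \<open>K\<close>
  is nonnegative.\<close>

lemma ladder_integral_diff_bounds:
  assumes y: "1 \<le> y1" "y1 \<le> y2"
  defines "a \<equiv> 2 / y1" and "b \<equiv> 2 / y2"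
  shows "(a - b) * truncated_moment a (mu y1) \<le> ladder_integral y2 - ladder_integral y1"
    and "ladder_integral y2 - ladder_integral y1 \<le> (a - b) * truncated_moment b (mu y1) + integral {mu y1..mu y2} (\<lambda>t. Z2 t * exp (- b * t))"
proof -
  define X1 X2 where "X1 = mu y1" and "X2 = mu y2"
  have X: "0 \<le> X1" "X1 \<le> X2" using mu_diff_le[OF y] by (auto simp: X1_def X2_def)
  have int: "(\<lambda>t. Z2 t * exp (- c * t)) integrable_on {p..q}" for c p q
    by (intro integrable_continuous_interval continuous_intros)
  have int': "(\<lambda>t. (a - b) * (t * exp (- c * t) * Z2 t)) integrable_on {p..q}" for c p q
    by (intro integrable_continuous_interval continuous_intros)
  have tf: "(a - b) * truncated_moment c X1 = integral {0..X1} (\<lambda>t. (a - b) * (t * exp (- c * t) * Z2 t))" for c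
    by (simp add: truncated_moment_def)
  define J where "J = integral {0..X1} (\<lambda>t. Z2 t * exp (- b * t) - Z2 t * exp (- a * t))"
  define K where "K = integral {X1..X2} (\<lambda>t. Z2 t * exp (- b * t))"
  have idiff: "(\<lambda>t. Z2 t * exp (- b * t) - Z2 t * exp (- a * t)) integrable_on {0..X1}"
    by (intro integrable_diff int)
  have "ladder_integral y2 = integral {0..X1} (\<lambda>t. Z2 t * exp (- b * t)) + K"
    unfolding ladder_integral_def K_def b_def[symmetric] X2_def[symmetric]
    using Henstock_Kurzweil_Integration.integral_combine[OF X(1) X(2) int[of b]] by simp
  moreover have "ladder_integral y1 = integral {0..X1} (\<lambda>t. Z2 t * exp (- a * t))"
    by (simp add: ladder_integral_def a_def X1_def)
  moreover have "J = integral {0..X1} (\<lambda>t. Z2 t * exp (- b * t)) - integral {0..X1} (\<lambda>t. Z2 t * exp (- a * t))"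
    unfolding J_def by (intro Henstock_Kurzweil_Integration.integral_diff int)
  ultimately have FJ: "ladder_integral y2 - ladder_integral y1 = J + K" by simp
  have K0: "0 \<le> K" unfolding K_def by (intro integral_nonneg int) (auto simp: Z2_nonneg)
  have "(a - b) * truncated_moment a X1 \<le> J"
    unfolding tf J_def
  proof (rule integral_le[OF int' idiff])
    fix t
    show "(a - b) * (t * exp (- a * t) * Z2 t) \<le> Z2 t * exp (- b * t) - Z2 t * exp (- a * t)"
      using mult_left_mono[OF exp_diff_bounds(1)[of a b t] Z2_nonneg[of t]] by (simp add: algebra_simps)
  qed
  thus "(a - b) * truncated_moment a (mu y1) \<le> ladder_integral y2 - ladder_integral y1" using FJ K0 by (simp add: X1_def)
  have "J \<le> (a - b) * truncated_moment b X1"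
    unfolding tf J_def
  proof (rule integral_le[OF idiff int'])
    fix t
    show "Z2 t * exp (- b * t) - Z2 t * exp (- a * t) \<le> (a - b) * (t * exp (- b * t) * Z2 t)"
      using mult_left_mono[OF exp_diff_bounds(2)[of b t a] Z2_nonneg[of t]] by (simp add: algebra_simps)
  qed
  thus "ladder_integral y2 - ladder_integral y1 \<le> (a - b) * truncated_moment b (mu y1) + integral {mu y1..mu y2} (\<lambda>t. Z2 t * exp (- b * t))"
    using FJ by (simp add: X1_def X2_def K_def)
qed

text \<open>Since y1/y2 >= 1/2, the factor 7 in \<open>mu\<close> makes the exponential at most
  y1^-7 on the new range. There Z^2 is O(y1^4), and the length is at most 14 y1 (y2 - y1), so the
  exponential wins.\<close>

lemma boundary_term_bound:
  assumes y: "2 \<le> y1" "y1 \<le> y2" "y2 \<le> y1 + 1"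
  shows "integral {mu y1..mu y2} (\<lambda>t. Z2 t * exp (- (2 / y2) * t)) \<le> 88256 * (y2 - y1)"
proof -
  define X1 X2 where "X1 = mu y1" and "X2 = mu y2"
  have y12: "1 \<le> y1" "y2 \<le> 2 * y1" "0 < y1" "0 < y2" using y by auto
  have X: "0 \<le> X1" "X1 \<le> X2" "X2 - X1 \<le> 7 * (y2 - y1) * (ln y2 + 1)"
    using mu_diff_le[OF y12(1) y(2)] by (auto simp: X1_def X2_def)
  have l2: "ln y2 \<le> y2 - 1" using y12 by (intro ln_le_minus_one) auto
  have e: "exp (- (2 / y2) * X1) \<le> 1 / y1 ^ 7"
  proof -
    have "7 * ln y1 \<le> 14 * ln y1 * (y1 / y2)"
    proof -
      have "1 / 2 \<le> y1 / y2" using y12 by (simp add: field_simps)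
      hence "14 * ln y1 * (1 / 2) \<le> 14 * ln y1 * (y1 / y2)" using y by (intro mult_left_mono) auto
      thus ?thesis by simp
    qed
    hence "exp (- (2 / y2) * X1) \<le> exp (- (7 * ln y1))" by (simp add: X1_def mu_def mult_ac)
    also have "\<dots> = 1 / exp (ln y1) ^ 7" by (simp add: exp_minus inverse_eq_divide flip: exp_of_nat_mult)
    finally show ?thesis using y12 by simp
  qed
  have X2: "X2 \<le> 28 * y1\<^sup>2"
  proof -
    have "X2 \<le> 7 * y2 * y2" unfolding X2_def mu_def using l2 y12 by (intro mult_left_mono) auto
    also have "\<dots> \<le> 7 * (2 * y1) * (2 * y1)" using y12 by (intro mult_mono) auto
    finally show ?thesis by (simp add: power2_eq_square)
  qed
  define B where "B = (32 + 8 * (28 * y1\<^sup>2)\<^sup>2) * (1 / y1 ^ 7)"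
  have "integral {X1..X2} (\<lambda>t. Z2 t * exp (- (2 / y2) * t)) \<le> integral {X1..X2} (\<lambda>t. B)"
  proof (rule integral_le)
    show "(\<lambda>t. Z2 t * exp (- (2 / y2) * t)) integrable_on {X1..X2}"
      by (intro integrable_continuous_interval continuous_intros)
    fix t assume t: "t \<in> {X1..X2}"
    have "t\<^sup>2 \<le> (28 * y1\<^sup>2)\<^sup>2" using t X X2 by (intro power_mono) auto
    hence "Z2 t \<le> 32 + 8 * (28 * y1\<^sup>2)\<^sup>2" using Z2_le[of t] by linarith
    moreover have "exp (- (2 / y2) * t) \<le> 1 / y1 ^ 7"
    proof -
      have "(2 / y2) * X1 \<le> (2 / y2) * t" using t y12 by (intro mult_left_mono) auto
      hence "exp (- (2 / y2) * t) \<le> exp (- (2 / y2) * X1)" by simp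
      thus ?thesis using e by linarith
    qed
    ultimately show "Z2 t * exp (- (2 / y2) * t) \<le> B"
      unfolding B_def by (intro mult_mono) auto
  qed auto
  also have "\<dots> = (X2 - X1) * B" using X by simp
  also have "\<dots> \<le> (14 * y1 * (y2 - y1)) * B"
  proof (rule mult_right_mono)
    have "7 * (y2 - y1) * (ln y2 + 1) \<le> 7 * (y2 - y1) * (2 * y1)"
      using l2 y y12 by (intro mult_left_mono) auto
    thus "X2 - X1 \<le> 14 * y1 * (y2 - y1)" using X(3) by (simp add: mult_ac)
    show "0 \<le> B" unfolding B_def using y12 by auto
  qed
  \<comment> \<open>Here 6304 = 8 * 28^2 + 32, both powers of y1 being raised to the sixth; finally
    14 * 6304 = 88256.\<close>
  also have "\<dots> \<le> (14 * y1 * (y2 - y1)) * (6304 / y1)"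
  proof (rule mult_left_mono)
    have p: "1 \<le> y1 ^ 6" "y1 ^ 4 \<le> y1 ^ 6"
      using y12 by (auto intro: one_le_power power_increasing)
    have "32 + 8 * (28 * y1\<^sup>2)\<^sup>2 = 32 + 6272 * y1 ^ 4" by (simp add: power_mult_distrib flip: power_mult)
    also have "\<dots> \<le> 6304 * y1 ^ 6" using p by linarith
    finally have "B \<le> 6304 * y1 ^ 6 * (1 / y1 ^ 7)"
      unfolding B_def using y12 by (intro mult_right_mono) auto
    also have "\<dots> = 6304 / y1" using y12 by (simp add: eval_nat_numeral)
    finally show "B \<le> 6304 / y1" .
    show "0 \<le> 14 * y1 * (y2 - y1)" using y y12 by simp
  qed
  also have "\<dots> = 88256 * (y2 - y1)" using y12 by simp
  finally show ?thesis by (simp add: X1_def X2_def)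
qed

text \<open>
  Over a step of length at most 1 the convexity of the exponential compares the increment with
  \<open>moment (2 / y1)\<close> and \<open>moment (2 / y2)\<close>, so no derivative of \<open>ladder_integral\<close> is needed.
\<close>

lemma ladder_integral_step:
  "\<exists>C0\<ge>0. \<forall>y1 y2. 2 \<le> y1 \<and> y1 \<le> y2 \<and> y2 \<le> y1 + 1 \<longrightarrow>
     (ln y1 / 2 - C0) * (y2 - y1) \<le> ladder_integral y2 - ladder_integral y1 \<and> ladder_integral y2 - ladder_integral y1 \<le> (ln y2 / 2 + C0) * (y2 - y1)"
proof -
  obtain C' where C': "\<And>d. 0 < d \<Longrightarrow> d \<le> 1 \<Longrightarrow> \<bar>moment d - ln (1 / d) / d\<^sup>2\<bar> \<le> C' / d\<^sup>2"
    using moment_asymptotics by blast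
  define C where "C = max C' 0"
  have C0: "0 \<le> C" by (simp add: C_def)
  have C: "\<bar>moment (1 / z) - ln z * z\<^sup>2\<bar> \<le> C * z\<^sup>2" if "1 \<le> z" for z
  proof -
    have "\<bar>moment (1 / z) - ln z * z\<^sup>2\<bar> \<le> C' * z\<^sup>2"
      using C'[of "1 / z"] that by (simp add: power_divide)
    also have "\<dots> \<le> C * z\<^sup>2" by (intro mult_right_mono) (auto simp: C_def)
    finally show ?thesis .
  qed
  have ln2: "ln (2::real) \<le> 1" using ln_le_minus_one[of 2] by simp
  show ?thesis
  \<comment> \<open>The upper bound needs 1 + C + 88256, the last summand being the boundary term;
    the lower bound needs (6 + 5 C) / 2. The witness covers both.\<close>
  proof (intro exI[of _ "88258 + 3 * C"] conjI allI impI)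
    show "0 \<le> 88258 + 3 * C" using C0 by simp
    fix y1 y2 :: real assume as: "2 \<le> y1 \<and> y1 \<le> y2 \<and> y2 \<le> y1 + 1"
    have y: "2 \<le> y1" "y1 \<le> y2" "y2 \<le> y1 + 1" "1 \<le> y1" "0 < y1" "0 < y2" using as by auto
    define a b where "a = 2 / y1" and "b = 2 / y2"
    \<comment> \<open>The factor 2 / (y1 y2) meets a moment of size y^2 ln y / 4; this is where the
      slope ln y / 2 comes from.\<close>
    have ab: "a - b = (y2 - y1) * (2 / (y1 * y2))" "0 \<le> a - b" "0 < a" "0 < b"
      using y by (auto simp: a_def b_def field_simps)
    have X: "0 \<le> mu y1" using mu_diff_le[OF y(4) y(2)] by simp
    have l1: "0 \<le> ln y1" "ln y1 \<le> y1" "ln y1 \<le> y2" "ln y2 \<le> y2" "0 \<le> ln y2"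
      using ln_le_minus_one[of y1] ln_le_minus_one[of y2] y by auto
    have La: "moment a \<ge> (ln y1 - 1 - C) * (y1\<^sup>2 / 4)"
    proof -
      have "moment a \<ge> (ln (y1 / 2) - C) * (y1 / 2)\<^sup>2"
        using C[of "y1 / 2"] y by (simp add: a_def left_diff_distrib)
      moreover have "(ln (y1 / 2) - C) * (y1 / 2)\<^sup>2 \<ge> (ln y1 - 1 - C) * (y1 / 2)\<^sup>2"
        using ln2 y by (intro mult_right_mono) (auto simp: ln_div)
      ultimately show ?thesis by (simp add: power_divide)
    qed
    have La2: "moment (a / 2) \<le> (ln y1 + C) * y1\<^sup>2"
      using C[of y1] y by (simp add: a_def distrib_right)
    have Lb: "moment b \<le> (ln y2 + C) * (y2\<^sup>2 / 4)"
    proof -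
      have "moment b \<le> (ln (y2 / 2) + C) * (y2 / 2)\<^sup>2"
        using C[of "y2 / 2"] y by (simp add: b_def distrib_right)
      also have "\<dots> \<le> (ln y2 + C) * (y2 / 2)\<^sup>2"
        using y by (intro mult_right_mono) (auto simp: ln_div)
      finally show ?thesis by (simp add: power_divide)
    qed
    have e: "exp (- a * mu y1 / 2) = 1 / y1 ^ 7"
    proof -
      have "- a * mu y1 / 2 = - (7 * ln y1)" using y by (simp add: a_def mu_def)
      hence "exp (- a * mu y1 / 2) = 1 / exp (ln y1) ^ 7" by (simp add: exp_minus inverse_eq_divide flip: exp_of_nat_mult)
      thus ?thesis using y by simp
    qed
    \<comment> \<open>The exponential is exactly y1^-7 because a mu(y1) / 2 = 7 ln y1, which
      outweighs the logarithm and the constant in the moment at a/2.\<close>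
    have tail: "exp (- a * mu y1 / 2) * moment (a / 2) \<le> (1 + C) * y1\<^sup>2"
    proof -
      have "exp (- a * mu y1 / 2) * moment (a / 2) \<le> 1 / y1 ^ 7 * ((ln y1 + C) * y1\<^sup>2)"
        unfolding e using La2 y by (intro mult_left_mono) auto
      also have "\<dots> \<le> 1 / y1 ^ 7 * ((y1 ^ 7 + C * y1 ^ 7) * y1\<^sup>2)"
      proof (intro mult_left_mono mult_right_mono add_mono)
        have "y1 ^ 1 \<le> y1 ^ 7" using y by (intro power_increasing) auto
        thus "ln y1 \<le> y1 ^ 7" using l1 by simp
        have "1 \<le> y1 ^ 7" using y by (intro one_le_power) auto
        from mult_left_mono[OF this C0] show "C \<le> C * y1 ^ 7" by simp
      qed (use y in auto)
      also have "\<dots> = (1 + C) * y1\<^sup>2" using y by (simp add: field_simps)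
      finally show ?thesis .
    qed
    have low: "(a - b) * ((ln y1 - 1 - C) * (y1\<^sup>2 / 4) - (1 + C) * y1\<^sup>2) \<le> ladder_integral y2 - ladder_integral y1"
    proof -
      have "(ln y1 - 1 - C) * (y1\<^sup>2 / 4) - (1 + C) * y1\<^sup>2 \<le> truncated_moment a (mu y1)"
        using truncated_moment_bounds(2)[OF ab(3) X] La tail by linarith
      from mult_left_mono[OF this ab(2)] show ?thesis
        using ladder_integral_diff_bounds(1)[OF y(4) y(2)] by (simp add: a_def b_def)
    qed
    have q: "y1 / y2 \<le> 1" "1 - 1 / y2 \<le> y1 / y2" "y2 / y1 \<le> 1 + 1 / y1"
    proof -
      show "y1 / y2 \<le> 1" using y by simp
      have "(y2 - 1) / y2 \<le> y1 / y2" using y by (intro divide_right_mono) auto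
      thus "1 - 1 / y2 \<le> y1 / y2" using y by (simp add: diff_divide_distrib)
      have "y2 / y1 \<le> (y1 + 1) / y1" using y by (intro divide_right_mono) auto
      thus "y2 / y1 \<le> 1 + 1 / y1" using y by (simp add: add_divide_distrib)
    qed
    have "(a - b) * ((ln y1 - 1 - C) * (y1\<^sup>2 / 4) - (1 + C) * y1\<^sup>2) = (y2 - y1) * ((ln y1 - 1 - C - 4 * (1 + C)) / 2 * (y1 / y2))"
      unfolding ab(1) using y by (simp add: field_simps power2_eq_square)
    moreover have "(y2 - y1) * ((ln y1 - 1 - C - 4 * (1 + C)) / 2 * (y1 / y2)) \<ge> (y2 - y1) * (ln y1 / 2 - (88258 + 3 * C))"
    proof (rule mult_left_mono)
      define c r where "c = 5 + 5 * C" and "r = y1 / y2"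
      have c0: "0 \<le> c" using C0 by (simp add: c_def)
      \<comment> \<open>Since y2 <= y1 + 1, replacing the ratio y1/y2 by 1 costs at most ln y1 / y2
        <= 1.\<close>
      have "ln y1 * (1 - 1 / y2) \<le> ln y1 * r" using q l1 by (intro mult_left_mono) (auto simp: r_def)
      moreover have "ln y1 * (1 / y2) \<le> 1" using l1 y by simp
      ultimately have "ln y1 - 1 \<le> ln y1 * r" by (simp add: right_diff_distrib)
      moreover have "c * r \<le> c" using q c0 by (intro mult_left_le) (auto simp: r_def)
      ultimately have "ln y1 - 1 - c \<le> (ln y1 - c) * r"
        unfolding left_diff_distrib by linarith
      moreover have "(ln y1 - 1 - C - 4 * (1 + C)) / 2 * (y1 / y2) = ((ln y1 - c) * r) / 2"
      proof -
        have "ln y1 - 1 - C - 4 * (1 + C) = ln y1 - c" by (simp add: c_def)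
        thus ?thesis by (simp only: r_def times_divide_eq_left)
      qed
      ultimately show "ln y1 / 2 - (88258 + 3 * C) \<le> (ln y1 - 1 - C - 4 * (1 + C)) / 2 * (y1 / y2)"
        using C0 c_def by linarith
    qed (use y in simp)
    ultimately show "(ln y1 / 2 - (88258 + 3 * C)) * (y2 - y1) \<le> ladder_integral y2 - ladder_integral y1"
      using low by (simp add: mult.commute)
    have "ladder_integral y2 - ladder_integral y1 \<le> (a - b) * truncated_moment b (mu y1) + 88256 * (y2 - y1)"
      using ladder_integral_diff_bounds(2)[OF y(4) y(2)] boundary_term_bound[OF y(1-3)] by (simp add: a_def b_def)
    also have "(a - b) * truncated_moment b (mu y1) \<le> (a - b) * ((ln y2 + C) * (y2\<^sup>2 / 4))"
      using truncated_moment_bounds(1)[OF ab(4) X] Lb ab(2) by (intro mult_left_mono) auto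
    also have "\<dots> = (y2 - y1) * ((ln y2 + C) / 2 * (y2 / y1))"
      unfolding ab(1) using y by (simp add: field_simps power2_eq_square)
    also have "\<dots> \<le> (y2 - y1) * (ln y2 / 2 + 1 + C)"
    proof (rule mult_left_mono)
      have "(ln y2 + C) * (y2 / y1) \<le> (ln y2 + C) * (1 + 1 / y1)"
        using q l1 C0 by (intro mult_left_mono) auto
      also have "\<dots> = ln y2 + C + ln y2 / y1 + C / y1" by (simp add: algebra_simps)
      also have "\<dots> \<le> ln y2 + C + 2 + C"
      proof -
        have "ln y2 / y1 \<le> 2" using l1 y by (simp add: divide_le_eq)
        moreover have "C / y1 \<le> C" using C0 y by (simp add: divide_le_eq mult_le_cancel_left1)
        ultimately show ?thesis by linarith
      qed
      finally show "(ln y2 + C) / 2 * (y2 / y1) \<le> ln y2 / 2 + 1 + C" by simp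
    qed (use y in simp)
    finally have "ladder_integral y2 - ladder_integral y1 \<le> (y2 - y1) * (ln y2 / 2 + 1 + C) + 88256 * (y2 - y1)" by simp
    also have "\<dots> = (ln y2 / 2 + 1 + C + 88256) * (y2 - y1)" by (simp add: algebra_simps)
    also have "\<dots> \<le> (ln y2 / 2 + (88258 + 3 * C)) * (y2 - y1)"
      using y C0 by (intro mult_right_mono) auto
    finally show "ladder_integral y2 - ladder_integral y1 \<le> (ln y2 / 2 + (88258 + 3 * C)) * (y2 - y1)" .
  qed
qed

text \<open>Chains steps of length at most 1. As the logarithm increases, ln y1 is a valid lower
  slope and ln y2 a valid upper slope for every step, so the constant does not grow with the number
  of steps.\<close>

lemma ladder_integral_increment:
  obtains C0 where "0 \<le> C0"
    "\<And>y1 y2. 2 \<le> y1 \<Longrightarrow> y1 \<le> y2 \<Longrightarrow> (ln y1 / 2 - C0) * (y2 - y1) \<le> ladder_integral y2 - ladder_integral y1"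
    "\<And>y1 y2. 2 \<le> y1 \<Longrightarrow> y1 \<le> y2 \<Longrightarrow> ladder_integral y2 - ladder_integral y1 \<le> (ln y2 / 2 + C0) * (y2 - y1)"
proof -
  obtain C0 where C0: "0 \<le> C0" and step: "\<And>y1 y2. 2 \<le> y1 \<Longrightarrow> y1 \<le> y2 \<Longrightarrow> y2 \<le> y1 + 1 \<Longrightarrow>
     (ln y1 / 2 - C0) * (y2 - y1) \<le> ladder_integral y2 - ladder_integral y1 \<and> ladder_integral y2 - ladder_integral y1 \<le> (ln y2 / 2 + C0) * (y2 - y1)"
    using ladder_integral_step by blast
  have main: "(ln y1 / 2 - C0) * (y2 - y1) \<le> ladder_integral y2 - ladder_integral y1 \<and> ladder_integral y2 - ladder_integral y1 \<le> (ln y2 / 2 + C0) * (y2 - y1)"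
    if "2 \<le> y1" "y1 \<le> y2" "y2 \<le> y1 + real (Suc n)" for y1 y2 n
    using that
  proof (induction n arbitrary: y2)
    case 0
    thus ?case using step by simp
  next
    case (Suc n)
    show ?case
    proof (cases "y2 \<le> y1 + 1")
      case True
      thus ?thesis using step Suc by simp
    next
      case False
      define z where "z = y2 - 1"
      have z: "y1 \<le> z" "z \<le> y2" "y2 \<le> z + 1" "2 \<le> z" "z \<le> y1 + real (Suc n)" using False Suc.prems by (auto simp: z_def)
      note 1 = Suc.IH[OF Suc.prems(1) z(1) z(5)]
      note 2 = step[OF z(4) z(2) z(3)]
      have l: "ln y1 \<le> ln z" "ln z \<le> ln y2" using z Suc.prems by auto
      have "(ln y1 / 2 - C0) * (y2 - z) \<le> (ln z / 2 - C0) * (y2 - z)"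
        using l z by (intro mult_right_mono) auto
      moreover have "(ln z / 2 + C0) * (z - y1) \<le> (ln y2 / 2 + C0) * (z - y1)"
        using l z by (intro mult_right_mono) auto
      moreover have "(ln y1 / 2 - C0) * (y2 - y1) = (ln y1 / 2 - C0) * (y2 - z) + (ln y1 / 2 - C0) * (z - y1)"
        "(ln y2 / 2 + C0) * (y2 - y1) = (ln y2 / 2 + C0) * (y2 - z) + (ln y2 / 2 + C0) * (z - y1)"
        by (simp_all flip: distrib_left)
      ultimately show ?thesis using 1 2 by linarith
    qed
  qed
  have ex: "\<exists>n. y2 \<le> y1 + real (Suc n)" for y1 y2 :: real
  proof -
    obtain n where "y2 - y1 \<le> real n" using real_arch_simple by blast
    thus ?thesis by (intro exI[of _ n]) simp
  qed
  show ?thesis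
    using that[OF C0] main ex by blast
qed

section \<open>Size of the ladder and chord slopes\<close>

lemma integral_Z2_mono:
  assumes "X \<le> Y" shows "integral {0..X} Z2 \<le> integral {0..Y} Z2"
  using assms by (intro integral_subset_le integrable_continuous_interval continuous_intros) (auto simp: Z2_nonneg)

lemma ladder_integral_le_integral_Z2:
  assumes "0 < y" shows "ladder_integral y \<le> integral {0..mu y} Z2"
  unfolding ladder_integral_def using assms
  by (intro integral_le integrable_continuous_interval continuous_intros)
     (auto simp: Z2_nonneg intro!: mult_left_le)

text \<open>On [0, T] the weight e^(-2t/T) is at least e^-2 >= 1/9, and this interval lies inside
  [0, mu T].\<close>

lemma integral_Z2_le_ladder_integral:
  assumes "exp 1 \<le> T" shows "integral {0..T} Z2 \<le> 9 * ladder_integral T"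
proof -
  have T: "1 \<le> T" "0 < T" using assms exp_ge_add_one_self[of 1] by linarith+
  have "1 \<le> ln T" using assms T by (simp add: ln_ge_iff)
  hence "T * 1 \<le> T * (7 * ln T)" using T by (intro mult_left_mono) auto
  hence muT: "T \<le> mu T" by (simp add: mu_def mult_ac)
  have int: "(\<lambda>t. Z2 t * exp (- (2 / T) * t)) integrable_on {p..q}" for p q
    by (intro integrable_continuous_interval continuous_intros)
  have "exp (2::real) = exp 1 * exp 1" by (simp flip: exp_add)
  also have "\<dots> \<le> 3 * 3" using exp_le by (intro mult_mono) auto
  finally have e: "exp (2::real) \<le> 9" by simp
  have "integral {0..T} Z2 \<le> integral {0..T} (\<lambda>t. exp 2 * (Z2 t * exp (- (2 / T) * t)))"
  proof (rule integral_le)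
    fix t assume t: "t \<in> {0..T}"
    have "(2 / T) * t \<le> 2" using t T by (simp add: field_simps)
    hence "1 \<le> exp (2 + - (2 / T) * t)" by simp
    hence "1 \<le> exp 2 * exp (- (2 / T) * t)" by (simp only: exp_add)
    from mult_left_mono[OF this Z2_nonneg[of t]]
    show "Z2 t \<le> exp 2 * (Z2 t * exp (- (2 / T) * t))" by (simp add: mult_ac)
  qed (intro integrable_continuous_interval continuous_intros)+
  also have "\<dots> = exp 2 * integral {0..T} (\<lambda>t. Z2 t * exp (- (2 / T) * t))" by simp
  also have "\<dots> \<le> exp 2 * ladder_integral T"
    unfolding ladder_integral_def using muT
    by (intro mult_left_mono integral_subset_le int) (auto simp: Z2_nonneg)
  also have "\<dots> \<le> 9 * ladder_integral T"
    using e unfolding ladder_integral_def by (intro mult_right_mono integral_nonneg int) (auto simp: Z2_nonneg)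
  finally show ?thesis .
qed

text \<open>Both bounds are by contradiction from the slope of F. If phi(T) were below y = T / (7 ln
  T), then F(phi(T)) < F(y), yet F(y) is at most the integral of Z^2 up to mu(y) <= T, which is
  F(phi(T)). If phi(T) exceeded 40T, F would have grown too much beyond F(T).\<close>

lemma ladder_size:
  assumes "jacobs_ladder \<phi> T0"
  shows "\<forall>\<^sub>F T in at_top. T / (7 * ln T) \<le> \<phi> T \<and> \<phi> T \<le> 40 * T"
proof -
  obtain C0 where C0: "0 \<le> C0" and
    lo: "\<And>y1 y2. 2 \<le> y1 \<Longrightarrow> y1 \<le> y2 \<Longrightarrow> (ln y1 / 2 - C0) * (y2 - y1) \<le> ladder_integral y2 - ladder_integral y1" and
    hi: "\<And>y1 y2. 2 \<le> y1 \<Longrightarrow> y1 \<le> y2 \<Longrightarrow> ladder_integral y2 - ladder_integral y1 \<le> (ln y2 / 2 + C0) * (y2 - y1)"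
    using ladder_integral_increment by metis
  \<comment> \<open>Beyond \<open>M\<close> the lower slope \<open>ln y / 2 - C0\<close> is at least
    1, so F is strictly increasing there.\<close>
  define M where "M = exp (2 * C0 + 2)"
  have M: "1 + (2 * C0 + 2) \<le> M" unfolding M_def by (rule exp_ge_add_one_self)
  have Mln: "1 \<le> ln y / 2 - C0" if "M \<le> y" for y
  proof -
    have "ln M \<le> ln y" using that M C0 by (intro ln_mono) auto
    thus ?thesis by (simp add: M_def)
  qed
  have lim: "filterlim \<phi> at_top at_top" and eq: "\<And>T. T0 \<le> T \<Longrightarrow> ladder_integral (\<phi> T) = integral {0..T} Z2"
    using assms by (auto simp: jacobs_ladder_def ladder_integral_def)
  have "filterlim (\<lambda>T::real. T / (7 * ln T)) at_top at_top" by real_asymp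
  hence e1: "\<forall>\<^sub>F T in at_top. M \<le> T / (7 * ln T)" by (simp add: filterlim_at_top)
  have e2: "\<forall>\<^sub>F T in at_top. M \<le> \<phi> T" using lim by (simp add: filterlim_at_top)
  have e3: "\<forall>\<^sub>F T in at_top. ladder_integral 2 + C0 * T \<le> T * ln T / 2" by real_asymp
  have e4: "\<forall>\<^sub>F T::real in at_top. 4 * C0 \<le> ln T" by real_asymp
  show ?thesis
    using e1 e2 e3 e4 eventually_ge_at_top[of T0] eventually_ge_at_top[of "exp 1"] eventually_ge_at_top[of M]
  proof eventually_elim
    case (elim T)
    have T1: "1 < T" "0 < T" using elim(6) exp_ge_add_one_self[of 1] by linarith+
    have lT: "1 \<le> ln T" using elim(6) T1 by (simp add: ln_ge_iff)
    define y where "y = T / (7 * ln T)"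
    have y: "M \<le> y" "0 < y" using elim(1) M C0 by (auto simp: y_def)
    have phi: "M \<le> \<phi> T" "2 \<le> \<phi> T" using elim(2) M C0 by auto
    have "y \<le> \<phi> T"
    proof (rule ccontr)
      assume "\<not> y \<le> \<phi> T"
      hence less: "\<phi> T < y" by simp
      have "1 * (y - \<phi> T) \<le> (ln (\<phi> T) / 2 - C0) * (y - \<phi> T)"
        using less Mln[OF phi(1)] by (intro mult_right_mono) auto
      also have "\<dots> \<le> ladder_integral y - ladder_integral (\<phi> T)" using lo phi less by simp
      finally have "ladder_integral (\<phi> T) < ladder_integral y" using less by simp
      also have "ladder_integral y \<le> integral {0..mu y} Z2" using y by (intro ladder_integral_le_integral_Z2)
      also have "\<dots> \<le> integral {0..T} Z2"
      proof (rule integral_Z2_mono)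
        have "T / (7 * ln T) \<le> T / 1" using T1 lT by (intro divide_left_mono) auto
        hence "ln y \<le> ln T" using y by (intro ln_mono) (auto simp: y_def)
        hence "7 * y * ln y \<le> 7 * y * ln T" using y by (intro mult_left_mono) auto
        also have "\<dots> = T" using lT by (simp add: y_def)
        finally show "mu y \<le> T" by (simp add: mu_def)
      qed
      also have "\<dots> = ladder_integral (\<phi> T)" using eq elim(5) by simp
      finally show False by simp
    qed
    \<comment> \<open>The slope is at least ln T / 4, so the growth beyond T would be at least
      (39/4) T ln T. But F(phi(T)) <= 9 F(T) and F(T) <= T ln T allow only 8 T ln T; the constant 40
      makes 39/4 exceed 8.\<close>
    moreover have "\<phi> T \<le> 40 * T"
    proof (rule ccontr)
      assume "\<not> \<phi> T \<le> 40 * T"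
      hence less: "40 * T < \<phi> T" by simp
      have T2: "2 \<le> T" using elim(7) M C0 by linarith
      have "(ln T / 4) * (39 * T) \<le> (ln T / 2 - C0) * (\<phi> T - T)"
        using elim(4) lT less T1 C0 by (intro mult_mono) auto
      also have "\<dots> \<le> ladder_integral (\<phi> T) - ladder_integral T" using lo T2 less T1 by simp
      also have "ladder_integral (\<phi> T) \<le> 9 * ladder_integral T" using eq elim(5) integral_Z2_le_ladder_integral[OF elim(6)] by simp
      finally have a: "(ln T / 4) * (39 * T) \<le> 8 * ladder_integral T" by simp
      have "ladder_integral T \<le> ladder_integral 2 + (ln T / 2 + C0) * (T - 2)" using hi[of 2 T] T2 by simp
      also have "(ln T / 2 + C0) * (T - 2) \<le> (ln T / 2 + C0) * T" using lT C0 by (intro mult_left_mono) auto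
      also have "ladder_integral 2 + (ln T / 2 + C0) * T \<le> T * ln T" using elim(3) by (simp add: algebra_simps)
      finally have "ladder_integral T \<le> T * ln T" by simp
      hence "(ln T / 4) * (39 * T) \<le> 8 * (T * ln T)" using a by linarith
      moreover have "(ln T / 4) * (39 * T) = 39 / 4 * (T * ln T)" by simp
      moreover have "0 < T * ln T" using T1 lT by simp
      ultimately show False by linarith
    qed
    ultimately show ?case by (simp add: y_def)
  qed
qed

theorem mainTheorem1:
  fixes \<phi> :: "real \<Rightarrow> real" and T0 :: real
  assumes "jacobs_ladder \<phi> T0"
  shows "\<exists>C T1. \<forall>T \<ge> T1. \<forall>U. 0 < U \<and> U \<le> T / ln T \<longrightarrow>
           (\<exists>R. \<bar>R\<bar> \<le> C * ln (ln T) / ln T \<and>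
                integral {T..T+U} Z2 = U * ln T * tan_alpha \<phi> T U * (1 + R))"
proof -
  obtain C0 where C0: "0 \<le> C0" and
    lo: "\<And>y1 y2. 2 \<le> y1 \<Longrightarrow> y1 \<le> y2 \<Longrightarrow> (ln y1 / 2 - C0) * (y2 - y1) \<le> ladder_integral y2 - ladder_integral y1" and
    hi: "\<And>y1 y2. 2 \<le> y1 \<Longrightarrow> y1 \<le> y2 \<Longrightarrow> ladder_integral y2 - ladder_integral y1 \<le> (ln y2 / 2 + C0) * (y2 - y1)"
    using ladder_integral_increment by metis
  have mono: "strict_mono_on {T0..} \<phi>" and lim: "filterlim \<phi> at_top at_top"
    and eq: "\<And>T. T0 \<le> T \<Longrightarrow> ladder_integral (\<phi> T) = integral {0..T} Z2"
    using assms by (auto simp: jacobs_ladder_def ladder_integral_def)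
  have e2: "\<forall>\<^sub>F T in at_top. 2 \<le> \<phi> T" using lim by (simp add: filterlim_at_top)
  have e3: "\<forall>\<^sub>F T in at_top. 1 \<le> ln (ln (T::real))" by real_asymp
  \<comment> \<open>All conditions hold from one threshold on, so they are available at T and at T +
    U alike; this gives uniformity in U.\<close>
  obtain T1 where T1: "\<And>T. T1 \<le> T \<Longrightarrow> T / (7 * ln T) \<le> \<phi> T \<and> \<phi> T \<le> 40 * T \<and> 2 \<le> \<phi> T \<and> 1 \<le> ln (ln T) \<and> T0 \<le> T \<and> exp 1 \<le> T"
    using eventually_conj[OF ladder_size[OF assms] eventually_conj[OF e2 eventually_conj[OF e3
      eventually_conj[OF eventually_ge_at_top[of T0] eventually_ge_at_top[of "exp 1"]]]]]
    unfolding eventually_at_top_linorder by blast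
  \<comment> \<open>Here 80 comes from phi(T + U) <= 40 (T + U) <= 80 T, the 1 from the ln ln T lost
    in the lower bound for phi(T), and 2 C0 from the slope error. Since ln ln T >= 1, constants are
    absorbed into ln ln T.\<close>
  define C where "C = 1 + ln 80 + 2 * C0"
  show ?thesis
  proof (rule exI[of _ C], rule exI[of _ T1], intro allI impI)
    fix T U assume T: "T1 \<le> T" and U: "0 < U \<and> U \<le> T / ln T"
    define a b where "a = \<phi> T" and "b = \<phi> (T + U)"
    have TU: "T1 \<le> T + U" using T U by simp
    have T0: "T0 \<le> T" "exp 1 \<le> T" "1 \<le> ln (ln T)" using T1[OF T] by auto
    have Tp: "1 < T" "0 < T" using T0(2) exp_ge_add_one_self[of 1] by linarith+
    have lT: "1 \<le> ln T" using T0 Tp by (simp add: ln_ge_iff)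
    have "T / ln T \<le> T / 1" using lT Tp by (intro divide_left_mono) auto
    hence UT: "U \<le> T" using U by simp
    have ab: "a < b" unfolding a_def b_def using mono T0 U by (intro strict_mono_onD[OF mono]) auto
    have a: "2 \<le> a" "T / (7 * ln T) \<le> a" using T1[OF T] by (auto simp: a_def)
    have b: "b \<le> 80 * T" using T1[OF TU] UT by (auto simp: b_def)
    define J where "J = integral {T..T+U} Z2"
    have J: "J = ladder_integral b - ladder_integral a"
    proof -
      have "integral {0..T} Z2 + integral {T..T+U} Z2 = integral {0..T+U} Z2"
        using Tp U by (intro Henstock_Kurzweil_Integration.integral_combine integrable_continuous_interval continuous_intros) auto
      thus ?thesis using eq[of T] eq[of "T + U"] T0 U by (simp add: J_def a_def b_def)
    qed
    \<comment> \<open>The mean slope of F between phi(T) and phi(T + U), caught between the slope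
      bounds at the two ends.\<close>
    define q where "q = J / (b - a)"
    have q1: "ln a / 2 - C0 \<le> q" using lo[of a b] a ab J by (simp add: q_def pos_le_divide_eq)
    have q2: "q \<le> ln b / 2 + C0" using hi[of a b] a ab J by (simp add: q_def pos_divide_le_eq)
    have "ln (T / (7 * ln T)) \<le> ln a" using a Tp lT by (intro ln_mono) auto
    hence la: "ln T - ln 7 - ln (ln T) \<le> ln a" using Tp lT by (simp add: ln_div ln_mult)
    have "ln b \<le> ln (80 * T)" using b a ab by (intro ln_mono) auto
    hence lb: "ln b \<le> ln 80 + ln T" using Tp by (simp add: ln_mult)
    have l7: "ln (7::real) \<le> ln 80" "0 \<le> ln (80::real)" by simp_all
    have bound: "\<bar>2 * q - ln T\<bar> \<le> C * ln (ln T)"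
    proof -
      have "2 * q - ln T \<le> ln (ln T) + (ln 80 + 2 * C0)" using q2 lb T0(3) by linarith
      moreover have "- (2 * q - ln T) \<le> ln (ln T) + (ln 80 + 2 * C0)" using q1 la l7(1) by linarith
      ultimately have "\<bar>2 * q - ln T\<bar> \<le> ln (ln T) + (ln 80 + 2 * C0) * 1" by (simp add: abs_le_iff)
      also have "\<dots> \<le> ln (ln T) + (ln 80 + 2 * C0) * ln (ln T)"
        using T0(3) C0 l7 by (intro add_left_mono mult_left_mono) auto
      also have "\<dots> = C * ln (ln T)" by (simp add: C_def algebra_simps)
      finally show ?thesis .
    qed
    \<comment> \<open>Chosen to make the identity exact: J = q (b - a), while U tan alpha = (b - a)
      / 2, so 1 + R must be 2q / ln T.\<close>
    define R where "R = (2 * q - ln T) / ln T"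
    have "\<bar>R\<bar> \<le> C * ln (ln T) / ln T"
      unfolding R_def abs_divide using bound lT by (simp add: divide_right_mono)
    moreover have "J = U * ln T * tan_alpha \<phi> T U * (1 + R)"
    proof -
      have 1: "1 + R = 2 * q / ln T" using lT by (simp add: R_def diff_divide_distrib)
      have 2: "U * ln T * tan_alpha \<phi> T U = ln T * (b - a) / 2"
        using U by (simp add: tan_alpha_def a_def b_def)
      show ?thesis unfolding 1 2 using lT ab by (simp add: q_def)
    qed
    ultimately show "\<exists>R. \<bar>R\<bar> \<le> C * ln (ln T) / ln T \<and>
                integral {T..T+U} Z2 = U * ln T * tan_alpha \<phi> T U * (1 + R)"
      by (auto simp: J_def)
  qed
qed

end
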